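(* Let $d=1$, let the weighting $\mathbf{w}$ be fixed (independent of $\mathbf{m}$), and let $\mathbf{m}\in\mathcal{R}_M$. Define $h_l(f):=f\log f+\lambda\kappa_lf$ and $$\eta(\mathbf{m}):=\sum_l\Delta v_l\,h_l\big(f^{\ast}_l(\mathbf{m})\big),\qquad \psi(\mathbf{m}):=\sum_l\Delta v_l\,v_l\,h_l\big(f^{\ast}_l(\mathbf{m})\big).$$ Then: (i) $\eta$ is strictly convex on $\mathcal{R}_M$, with $\nabla\eta=-\mathbf{y}^{\ast}$ and $\nabla^2\eta=\mathcal{H}^{-1}\succ0$; the pair $(\eta,\psi)$ is an entropy/entropy-flux pair for the system $\partial_t\mathbf{m}+\partial_x\mathbf{F}(\mathbf{m})=0$, i.e. $\nabla\psi=\mathbf{F}'(\mathbf{m})^T\nabla\eta$; and $\mathbf{F}'(\mathbf{m})=\mathcal{K}\mathcal{H}^{-1}$, so that the system is symmetric hyperbolic with symmetrizer $\mathcal{H}^{-1}$ (i.e. $\mathcal{H}^{-1}$ is symmetric positive definite and $\mathcal{H}^{-1}\mathbf{F}'(\mathbf{m})$ is symmetric). (ii) The characteristic speeds of the system (the eigenvalues of $\mathbf{F}'(\mathbf{m})$) are the $M$ nodes $\theta_1,\ldots,\theta_M$ of the $M$-point Gauss quadrature rule associated with the reconstructed measure $\mu^{\ast}=\sum_l\Delta v_lf^{\ast}_l(\mathbf{m})\,\delta_{v_l}$. They are real and pairwise distinct, so that the system is strictly hyperbolic at every $\mathbf{m}\in\mathcal{R}_M$, and they satisfy the state-independent bound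 $$v_1<\theta_1<\theta_2<\cdots<\theta_M<v_N.$$
   Context: Fixed data: integers $N>M\ge1$; distinct velocity nodes $v_1<v_2<\cdots<v_N$ in $\mathbb{R}$; quadrature weights $\Delta v_l>0$; $\lambda\ge0$; weighting values $w_l>0$. Constraint monomials $p_k(v)=v^{k-1}$, $k=1,\ldots,M$, $\mathbf{p}=(p_1,\ldots,p_M)^T$; single predicted moment $q(v)=v^M$. $\mathbf{A}\in\mathbb{R}^{M\times N}$ with $\mathbf{A}_{kl}=\Delta v_l\,p_k(v_l)$, assumed of rank $M$; $\mathbf{A}_{\mathrm{next}}=(\Delta v_lv_l^M)_{l}$ ($1\times N$). The nodes, $\Delta v_l$ and $\mathbf{A}$ are fixed. Realizability cone $\mathcal{R}_M=\{\mathbf{A}\mathbf{f}:\mathbf{f}\in\mathbb{R}^N,\ f_l>0\ \forall l\}$, an open subset of $\mathbb{R}^M$. Primal problem: for $\mathbf{m}\in\mathcal{R}_M$, minimize $\sum_l\Delta v_lw_lg_l\log(w_lg_l)+\lambda\sum_l|g_l|$ over $\mathbf{g}$ with $g_l\ge0$, $\sum_l\mathbf{A}_{kl}w_lg_l=m_k$ ($k=1,\ldots,M$), with $0\log0=0$; it has a unique solution $\mathbf{g}^{\ast}$, which is positive, and $f^{\ast}_l(\mathbf{m})=w_lg^{\ast}_l$. With $\kappa_l=1/(\Delta v_lw_l)$, $\mathbf{y}^{\ast}(\mathbf{m})$ is the minimizer over $\mathbf{y}\in\mathbb{R}^M$ of the dual function $\Psi(\mathbf{y};\mathbf{m})=\mathbf{y}^T\mathbf{m}+\sum_l\Delta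 v_l\exp(-1-\lambda\kappa_l-\mathbf{y}^T\mathbf{p}(v_l))$, and $f^{\ast}_l=\exp(-1-\lambda\kappa_l-(\mathbf{y}^{\ast})^T\mathbf{p}(v_l))$. Flux of the closed moment system: $\mathbf{F}(\mathbf{m})=(m_2,\ldots,m_M,\mathbf{A}_{\mathrm{next}}\mathbf{f}^{\ast}(\mathbf{m}))^T=\sum_l\Delta v_lv_l\,\mathbf{p}(v_l)f^{\ast}_l(\mathbf{m})$; $\mathbf{F}'$ is its Jacobian. Gram matrices: $\mathcal{H}=\sum_l\Delta v_lf^{\ast}_l\,\mathbf{p}(v_l)\mathbf{p}(v_l)^T$, $\mathcal{K}=\sum_l\Delta v_lv_lf^{\ast}_l\,\mathbf{p}(v_l)\mathbf{p}(v_l)^T$. The nodes of the $M$-point Gauss rule of $\mu^{\ast}$ are the zeros of the degree-$M$ orthogonal polynomial of $\mu^{\ast}$. Strictly hyperbolic means that the flux Jacobian has $M$ pairwise distinct real eigenvalues. *)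

theory Defs
  imports "HOL-Analysis.Analysis" "HOL-Computational_Algebra.Polynomial"
begin

section \<open>General notions\<close>

definition strictly_convex_on :: "'a::real_vector set \<Rightarrow> ('a \<Rightarrow> real) \<Rightarrow> bool" where
  "strictly_convex_on S f \<longleftrightarrow> convex S \<and>
    (\<forall>x\<in>S. \<forall>y\<in>S. \<forall>a>0. \<forall>b>0. x \<noteq> y \<longrightarrow> a + b = 1 \<longrightarrow>
       f (a *\<^sub>R x + b *\<^sub>R y) < a * f x + b * f y)"

definition has_hessian :: "(real^'k \<Rightarrow> real) \<Rightarrow> real^'k^'k \<Rightarrow> real^'k \<Rightarrow> bool" where
  "has_hessian f Q x \<longleftrightarrow>
     (\<exists>G. (\<forall>\<^sub>F y in nhds x. GDERIV f y :> G y) \<and> (G has_derivative (\<lambda>h. Q *v h)) (at x))"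

definition sym_matrix :: "real^'k^'k \<Rightarrow> bool" where
  "sym_matrix Q \<longleftrightarrow> transpose Q = Q"

definition sym_pos_def :: "real^'k^'k \<Rightarrow> bool" where
  "sym_pos_def Q \<longleftrightarrow> sym_matrix Q \<and> (\<forall>x. x \<noteq> 0 \<longrightarrow> x \<bullet> (Q *v x) > 0)"

text \<open>All complex eigenvalues of a real matrix, so that their being real is a genuine claim.\<close>

definition eigenvals :: "real^'k^'k \<Rightarrow> complex set" where
  "eigenvals Q = {z. \<exists>x. x \<noteq> 0 \<and> map_matrix complex_of_real Q *v x = z *s x}"

definition strictly_hyperbolic_at :: "(real^'k \<Rightarrow> real^'k) \<Rightarrow> real^'k \<Rightarrow> bool" where
  "strictly_hyperbolic_at F x \<longleftrightarrow> F differentiable (at x) \<and>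
     eigenvals (jacobian F (at x)) \<subseteq> \<real> \<and> card (eigenvals (jacobian F (at x))) = CARD('k)"

definition symmetric_hyperbolic_at ::
    "(real^'k \<Rightarrow> real^'k) \<Rightarrow> real^'k^'k \<Rightarrow> real^'k \<Rightarrow> bool" where
  "symmetric_hyperbolic_at F S x \<longleftrightarrow> F differentiable (at x) \<and>
     sym_pos_def S \<and> sym_matrix (S ** jacobian F (at x))"

definition entropy_pair_at ::
    "(real^'k \<Rightarrow> real^'k) \<Rightarrow> (real^'k \<Rightarrow> real) \<Rightarrow> (real^'k \<Rightarrow> real) \<Rightarrow> real^'k \<Rightarrow> bool" where
  "entropy_pair_at F \<eta> \<psi> x \<longleftrightarrow> F differentiable (at x) \<and>
     (\<exists>G. GDERIV \<eta> x :> G \<and> GDERIV \<psi> x :> transpose (jacobian F (at x)) *v G)"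

definition monic_orthogonal_poly :: "real measure \<Rightarrow> nat \<Rightarrow> real poly \<Rightarrow> bool" where
  "monic_orthogonal_poly \<mu> n P \<longleftrightarrow> degree P = n \<and> lead_coeff P = 1 \<and>
     (\<forall>Q. degree Q < n \<longrightarrow> integrable \<mu> (\<lambda>x. poly P x * poly Q x) \<and>
        (\<integral>x. poly P x * poly Q x \<partial>\<mu>) = 0)"

text \<open>Meaningful for \<open>n \<ge> 1\<close> when \<open>\<mu>\<close> has finite moments and at least \<open>n\<close> points in its
  support; then the monic orthogonal polynomial of degree \<open>n\<close> exists and is unique.\<close>

definition gauss_nodes :: "real measure \<Rightarrow> nat \<Rightarrow> real set" where
  "gauss_nodes \<mu> n = {x. poly (THE P. monic_orthogonal_poly \<mu> n P) x = 0}"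


section \<open>The discrete entropy closure\<close>

text \<open>The velocity index \<open>l = 1, \<dots>, N\<close> and the moment index \<open>k = 1, \<dots>, M\<close> are the elements, in
  increasing order, of linearly ordered finite types \<open>'n\<close> and \<open>'m\<close>; thus \<open>N = CARD('n)\<close> and
  \<open>M = CARD('m)\<close>, and both are at least 1.  The number of indices strictly below the \<open>k\<close>-th one
  is \<open>k - 1\<close>, which is the degree of the \<open>k\<close>-th constraint monomial.\<close>

definition index_degree :: "'m::{finite,linorder} \<Rightarrow> nat" where
  "index_degree k = card {j. j < k}"

definition pvec :: "real \<Rightarrow> real^'m::{finite,linorder}" where
  "pvec x = (\<chi> k. x ^ index_degree k)"

definition moment_matrix :: "real^'n \<Rightarrow> real^'n \<Rightarrow> real^'n^'m::{finite,linorder}" where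
  "moment_matrix v dv = (\<chi> k l. dv $ l * pvec (v $ l) $ k)"

definition next_row :: "real^'n \<Rightarrow> real^'n \<Rightarrow> nat \<Rightarrow> real^'n" where
  "next_row v dv M = (\<chi> l. dv $ l * v $ l ^ M)"

definition realizable :: "real^'n \<Rightarrow> real^'n \<Rightarrow> (real^'m::{finite,linorder}) set" where
  "realizable v dv = {moment_matrix v dv *v f | f. \<forall>l. f $ l > 0}"

text \<open>Since \<open>ln 0 = 0\<close>, the convention \<open>0 log 0 = 0\<close> is respected.\<close>

definition primal_objective :: "real^'n \<Rightarrow> real^'n \<Rightarrow> real \<Rightarrow> real^'n \<Rightarrow> real" where
  "primal_objective dv w lam g =
     (\<Sum>l\<in>UNIV. dv $ l * (w $ l * g $ l * ln (w $ l * g $ l))) + lam * (\<Sum>l\<in>UNIV. \<bar>g $ l\<bar>)"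

definition primal_feasible ::
    "real^'n \<Rightarrow> real^'n \<Rightarrow> real^'n \<Rightarrow> real^'m::{finite,linorder} \<Rightarrow> real^'n \<Rightarrow> bool" where
  "primal_feasible v dv w m g \<longleftrightarrow> (\<forall>l. g $ l \<ge> 0) \<and>
     moment_matrix v dv *v (\<chi> l. w $ l * g $ l) = m"

definition g_star ::
    "real^'n \<Rightarrow> real^'n \<Rightarrow> real^'n \<Rightarrow> real \<Rightarrow> real^'m::{finite,linorder} \<Rightarrow> real^'n" where
  "g_star v dv w lam m = (THE g. is_arg_min (primal_objective dv w lam) (primal_feasible v dv w m) g)"

definition f_star ::
    "real^'n \<Rightarrow> real^'n \<Rightarrow> real^'n \<Rightarrow> real \<Rightarrow> real^'m::{finite,linorder} \<Rightarrow> real^'n" where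
  "f_star v dv w lam m = (\<chi> l. w $ l * g_star v dv w lam m $ l)"

definition kappa :: "real^'n \<Rightarrow> real^'n \<Rightarrow> 'n \<Rightarrow> real" where
  "kappa dv w l = 1 / (dv $ l * w $ l)"

definition dual_function ::
    "real^'n \<Rightarrow> real^'n \<Rightarrow> real^'n \<Rightarrow> real \<Rightarrow> real^'m::{finite,linorder} \<Rightarrow> real^'m::{finite,linorder} \<Rightarrow> real" where
  "dual_function v dv w lam m y =
     y \<bullet> m + (\<Sum>l\<in>UNIV. dv $ l * exp (- 1 - lam * kappa dv w l - y \<bullet> pvec (v $ l)))"

definition y_star ::
    "real^'n \<Rightarrow> real^'n \<Rightarrow> real^'n \<Rightarrow> real \<Rightarrow> real^'m::{finite,linorder} \<Rightarrow> real^'m::{finite,linorder}" where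
  "y_star v dv w lam m = (THE y. is_arg_min (dual_function v dv w lam m) (\<lambda>_. True) y)"

text \<open>Every component but the last is the next moment; the last one is the predicted moment
  of degree \<open>M\<close>.\<close>

definition flux ::
    "real^'n \<Rightarrow> real^'n \<Rightarrow> real^'n \<Rightarrow> real \<Rightarrow> real^'m::{finite,linorder} \<Rightarrow> real^'m::{finite,linorder}" where
  "flux v dv w lam m =
     (\<chi> k. if \<exists>j. k < j then m $ (LEAST j. k < j)
           else next_row v dv CARD('m) \<bullet> f_star v dv w lam m)"

definition gram_H ::
    "real^'n \<Rightarrow> real^'n \<Rightarrow> real^'n \<Rightarrow> real \<Rightarrow> real^'m::{finite,linorder} \<Rightarrow> real^'m::{finite,linorder}^'m::{finite,linorder}" where
  "gram_H v dv w lam m = (\<chi> i j. \<Sum>l\<in>UNIV.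
     dv $ l * f_star v dv w lam m $ l * pvec (v $ l) $ i * pvec (v $ l) $ j)"

definition gram_K ::
    "real^'n \<Rightarrow> real^'n \<Rightarrow> real^'n \<Rightarrow> real \<Rightarrow> real^'m::{finite,linorder} \<Rightarrow> real^'m::{finite,linorder}^'m::{finite,linorder}" where
  "gram_K v dv w lam m = (\<chi> i j. \<Sum>l\<in>UNIV.
     dv $ l * v $ l * f_star v dv w lam m $ l * pvec (v $ l) $ i * pvec (v $ l) $ j)"

definition entropy_density :: "real^'n \<Rightarrow> real^'n \<Rightarrow> real \<Rightarrow> 'n \<Rightarrow> real \<Rightarrow> real" where
  "entropy_density dv w lam l x = x * ln x + lam * kappa dv w l * x"

definition closure_entropy ::
    "real^'n \<Rightarrow> real^'n \<Rightarrow> real^'n \<Rightarrow> real \<Rightarrow> real^'m::{finite,linorder} \<Rightarrow> real" where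
  "closure_entropy v dv w lam m =
     (\<Sum>l\<in>UNIV. dv $ l * entropy_density dv w lam l (f_star v dv w lam m $ l))"

definition closure_entropy_flux ::
    "real^'n \<Rightarrow> real^'n \<Rightarrow> real^'n \<Rightarrow> real \<Rightarrow> real^'m::{finite,linorder} \<Rightarrow> real" where
  "closure_entropy_flux v dv w lam m =
     (\<Sum>l\<in>UNIV. dv $ l * v $ l * entropy_density dv w lam l (f_star v dv w lam m $ l))"

text \<open>The measure \<open>\<Sum>l. dv l * f l * \<delta> (v l)\<close>, as the image under \<open>v\<close> of a weighted counting
  measure on the indices.\<close>

definition mu_star ::
    "real^'n \<Rightarrow> real^'n \<Rightarrow> real^'n \<Rightarrow> real \<Rightarrow> real^'m::{finite,linorder} \<Rightarrow> real measure" where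
  "mu_star v dv w lam m =
     distr (density (count_space UNIV) (\<lambda>l. ennreal (dv $ l * f_star v dv w lam m $ l))) borel (\<lambda>l. v $ l)"

end

theory Submission
  imports Defs "HOL-Computational_Algebra.Fundamental_Theorem_Algebra"
begin

text \<open>
  By convex duality the realizable moments are parametrized diffeomorphically by the dual variable
  \<open>y\<close> through the exponential densities, and \<open>y\<^sup>*\<close> is the inverse of this parametrization, with
  derivative \<open>-H\<^sup>-\<^sup>1\<close>; part (i) is then the chain rule together with a Bregman inequality.
  For part (ii), \<open>z\<close> is an eigenvalue of \<open>K H\<^sup>-\<^sup>1\<close> iff \<open>(X - z) U\<close> is orthogonal to all polynomials of
  degree less than \<open>M\<close> for some \<open>U \<noteq> 0\<close> of degree less than \<open>M\<close>, i.e. iff \<open>z\<close> is a zero of the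
  orthogonal polynomial of degree \<open>M\<close>.  Testing the orthogonality relation against conjugates of
  cofactors shows that these complex zeros are real, simple and strictly inside the node range.
\<close>

section \<open>Zeros of orthogonal polynomials of discrete measures\<close>

text \<open>Two obstacles shape the proof. \<open>g_star\<close>, \<open>y_star\<close> and the
  polynomial in \<open>gauss_nodes\<close> are definite descriptions, so each is evaluated by
  exhibiting a unique candidate. For the closure this happens at states
  \<open>moments (dens y)\<close>, where the candidate is explicit and strict tangent inequalities
  suffice; a single existence argument, coercivity of the dual function, then shows that every
  realizable state has this form. Eigenvalues are sought among the complex numbers, where the
  bilinear orthogonality relation is not definite. Since the nodes are real, conjugating the
  coefficients of a test polynomial conjugates its values at the nodes, which restores sums of
  squares. Nondegeneracy comes from M < N: a polynomial of degree less than M that vanishes at all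
  nodes but one is zero. One node is excluded because the factor \<open>X - z\<close> of the
  orthogonal polynomial may itself vanish at a node.\<close>

lemma poly_eq_0_if_almost_all_nodes:
  fixes v :: "'n::finite \<Rightarrow> real" and U :: "'a::{real_algebra_1, idom} poly"
  assumes "inj v" and "degree U + 1 < CARD('n)"
    and "\<And>l. v l \<noteq> x \<Longrightarrow> poly U (of_real (v l)) = 0"
  shows "U = 0"
proof (rule poly_eqI_degree)
  let ?A = "(\<lambda>l. of_real (v l) :: 'a) ` (UNIV - {l. v l = x})"
  show "poly U z = poly 0 z" if "z \<in> ?A" for z
    using that assms(3) by auto
  \<comment> \<open>Injectivity puts at most one index at \<open>x\<close>, so \<open>U\<close> has
    at least \<open>CARD('n) - 1\<close> zeros, exceeding its degree.\<close>
  have "card {l. v l = x} \<le> card {x}"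
    by (rule card_inj_on_le[of v]) (use assms(1) in \<open>auto simp: inj_def inj_on_def\<close>)
  then have "CARD('n) - 1 \<le> card (UNIV - {l. v l = x})"
    by (subst card_Diff_subset) auto
  moreover have "card ?A = card (UNIV - {l. v l = x})"
    using assms(1) by (intro card_image) (auto simp: inj_def inj_on_def)
  ultimately show "degree U < card ?A" and "degree (0 :: 'a poly) < card ?A"
    using assms(2) by simp_all
qed

text \<open>Bilinear, without conjugation, so that one notion serves real and complex polynomials;
  positivity enters later through the choice of \<open>Q\<close>.\<close>

definition orthogonal_to_lower ::
    "('n::finite \<Rightarrow> real) \<Rightarrow> ('n \<Rightarrow> real) \<Rightarrow> nat \<Rightarrow> 'a::{real_algebra_1, comm_ring_1} poly \<Rightarrow> bool" where
  "orthogonal_to_lower v c M P \<longleftrightarrow>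
     (\<forall>Q. degree Q < M \<longrightarrow>
       (\<Sum>l\<in>UNIV. of_real (c l) * poly P (of_real (v l)) * poly Q (of_real (v l))) = 0)"

lemma orthogonal_to_lowerD:
  "orthogonal_to_lower v c M P \<Longrightarrow> degree Q < M \<Longrightarrow>
    (\<Sum>l\<in>UNIV. of_real (c l) * poly P (of_real (v l)) * poly Q (of_real (v l))) = 0"
  by (simp add: orthogonal_to_lower_def)

lemma orthogonal_to_lower_iff_monomials:
  fixes P :: "'a::{real_algebra_1, comm_ring_1} poly"
  shows "orthogonal_to_lower v c M P \<longleftrightarrow>
    (\<forall>j<M. (\<Sum>l\<in>UNIV. of_real (c l) * poly P (of_real (v l)) * of_real (v l) ^ j) = 0)"
  (is "?L \<longleftrightarrow> ?R")
proof
  assume L: ?L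
  show ?R
  proof (intro allI impI)
    fix j assume "j < M"
    then have "degree (monom (1::'a) j) < M"
      by (simp add: degree_monom_eq)
    from L[unfolded orthogonal_to_lower_def, rule_format, OF this]
    show "(\<Sum>l\<in>UNIV. of_real (c l) * poly P (of_real (v l)) * of_real (v l) ^ j) = 0"
      by (simp add: poly_monom)
  qed
next
  assume R: ?R
  show ?L
    unfolding orthogonal_to_lower_def
  proof (intro allI impI)
    fix Q :: "'a poly" assume deg: "degree Q < M"
    have "(\<Sum>l\<in>UNIV. of_real (c l) * poly P (of_real (v l)) * poly Q (of_real (v l))) =
        (\<Sum>l\<in>UNIV. \<Sum>i\<le>degree Q. coeff Q i *
           (of_real (c l) * poly P (of_real (v l)) * of_real (v l) ^ i))"
      by (simp add: poly_altdef[of Q] sum_distrib_left mult_ac)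
    also have "\<dots> = (\<Sum>i\<le>degree Q. coeff Q i *
           (\<Sum>l\<in>UNIV. of_real (c l) * poly P (of_real (v l)) * of_real (v l) ^ i))"
      by (subst sum.swap) (simp add: sum_distrib_left)
    also have "\<dots> = 0"
      using R deg by (intro sum.neutral) auto
    finally show "(\<Sum>l\<in>UNIV. of_real (c l) * poly P (of_real (v l)) * poly Q (of_real (v l))) = 0" .
  qed
qed

lemma poly_map_poly_of_real:
  "poly (map_poly of_real p) (of_real x) = (of_real (poly p x) :: 'a::{real_algebra_1, comm_ring_1})"
  by (induction p) (simp_all add: map_poly_pCons)

text \<open>Tested on monomials, the relation for a real polynomial is an embedded real equation, so
  complex test polynomials add no condition.\<close>

lemma orthogonal_to_lower_of_real:
  "orthogonal_to_lower v c M (map_poly of_real P :: 'a::{real_algebra_1, comm_ring_1} poly) \<longleftrightarrow>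
   orthogonal_to_lower v c M (P :: real poly)"
proof -
  have "(\<Sum>l\<in>UNIV. of_real (c l) * poly (map_poly of_real P) (of_real (v l)) * of_real (v l) ^ j) =
     (of_real (\<Sum>l\<in>UNIV. c l * poly P (v l) * v l ^ j) :: 'a)" for j
    by (simp add: poly_map_poly_of_real)
  then have "(\<Sum>l\<in>UNIV. of_real (c l) * poly (map_poly of_real P) (of_real (v l)) * of_real (v l) ^ j)
       = (0 :: 'a) \<longleftrightarrow> (\<Sum>l\<in>UNIV. c l * poly P (v l) * v l ^ j) = 0" for j
    by (simp only: of_real_eq_0_iff)
  then show ?thesis
    by (simp only: orthogonal_to_lower_iff_monomials of_real_eq_id id_apply)
qed

lemma degree_map_poly_cnj [simp]: "degree (map_poly cnj p) = degree p"
  by (rule degree_map_poly) simp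

lemma poly_map_poly_cnj_of_real:
  "poly (map_poly cnj p) (complex_of_real x) = cnj (poly p (complex_of_real x))"
  using poly_cnj[of p "complex_of_real x"] by simp

text \<open>A root \<open>z\<close> of \<open>P = (X - z) U\<close> is a weighted mean of the nodes, with weights
  \<open>c l * \<bar>U (v l)\<bar>\<^sup>2\<close>: test the orthogonality relation against the conjugate of \<open>U\<close>.\<close>

lemma orthogonal_root_real:
  fixes v c :: "'n::finite \<Rightarrow> real" and P :: "complex poly"
  assumes inj: "inj v" and pos: "\<And>l. c l > 0" and M: "M < CARD('n)"
    and orth: "orthogonal_to_lower v c M P" and "P \<noteq> 0" and deg: "degree P \<le> M"
    and root: "poly P z = 0"
  shows "z \<in> \<real>" and "\<exists>l. v l < Re z" and "\<exists>l. Re z < v l"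
proof -
  from root obtain U where P: "P = [:-z, 1:] * U"
    by (auto simp: poly_eq_0_iff_dvd)
  then have "U \<noteq> 0"
    using \<open>P \<noteq> 0\<close> by auto
  then have degU: "degree U < M"
    using deg unfolding P by (subst (asm) degree_mult_eq) auto
  define s where "s l = c l * (cmod (poly U (v l)))\<^sup>2" for l
  have s_nonneg: "s l \<ge> 0" for l
    using pos[of l] by (simp add: s_def)
  \<comment> \<open>Otherwise \<open>U\<close> would vanish at every node other than
    \<open>x\<close>. The strict bounds below rest on this weight away from
    \<open>Re z\<close>.\<close>
  have not_all: "\<exists>l. v l \<noteq> x \<and> s l > 0" for x
  proof (rule ccontr)
    assume "\<not> ?thesis"
    then have "s l = 0" if "v l \<noteq> x" for l
      using that s_nonneg[of l] by fastforce
    then have "poly U (of_real (v l)) = 0" if "v l \<noteq> x" for l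
      using that pos[of l] by (fastforce simp: s_def)
    then have "U = 0"
      using poly_eq_0_if_almost_all_nodes[OF inj, of U x] degU M by auto
    then show False
      using \<open>U \<noteq> 0\<close> by simp
  qed
  have "(\<Sum>l\<in>UNIV. of_real (c l) * poly P (of_real (v l)) * poly (map_poly cnj U) (of_real (v l))) = 0"
    using degU by (intro orthogonal_to_lowerD[OF orth]) simp
  moreover have "of_real (c l) * poly P (of_real (v l)) * poly (map_poly cnj U) (of_real (v l)) =
     of_real (s l) * (of_real (v l) - z)" for l
    unfolding P s_def poly_map_poly_cnj_of_real of_real_mult complex_norm_square
    by (simp add: algebra_simps)
  ultimately have sum0: "(\<Sum>l\<in>UNIV. of_real (s l) * (of_real (v l) - z)) = 0"
    by simp
  have "(\<Sum>l\<in>UNIV. s l) * Im z = 0"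
    using arg_cong[OF sum0, of Im] by (simp add: sum_distrib_right sum_negf)
  moreover have "(\<Sum>l\<in>UNIV. s l) > 0"
    using not_all s_nonneg by (meson finite iso_tuple_UNIV_I sum_pos2)
  ultimately show "z \<in> \<real>"
    by (simp add: complex_is_Real_iff)
  have re: "(\<Sum>l\<in>UNIV. s l * (v l - Re z)) = 0"
    using arg_cong[OF sum0, of Re] by simp
  \<comment> \<open>With \<open>s l0 > 0\<close> off \<open>Re z\<close>, deviations of one sign
    could not sum to zero.\<close>
  obtain l0 where l0: "v l0 \<noteq> Re z" "s l0 > 0"
    using not_all by blast
  show "\<exists>l. v l < Re z"
  proof (rule ccontr)
    assume "\<not> ?thesis"
    then have "v l \<ge> Re z" for l by (auto simp: not_less)
    then have "(\<Sum>l\<in>UNIV. s l * (v l - Re z)) > 0"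
      using l0 s_nonneg by (intro sum_pos2[of UNIV l0]) (auto simp: less_le)
    then show False using re by simp
  qed
  show "\<exists>l. Re z < v l"
  proof (rule ccontr)
    assume "\<not> ?thesis"
    then have "v l \<le> Re z" for l by (auto simp: not_less)
    then have "(\<Sum>l\<in>UNIV. s l * (Re z - v l)) > 0"
      using l0 s_nonneg by (intro sum_pos2[of UNIV l0]) (auto simp: less_le)
    moreover have "(\<Sum>l\<in>UNIV. s l * (Re z - v l)) = - (\<Sum>l\<in>UNIV. s l * (v l - Re z))"
      by (simp add: sum_negf[symmetric] algebra_simps)
    ultimately show False using re by simp
  qed
qed

text \<open>At a double root \<open>z\<close> the cofactor \<open>V\<close> has degree at most M -
  2, so its conjugate is an admissible test. Since \<open>z\<close> is real, the squared factor is
  nonnegative at the nodes, and \<open>V\<close> must vanish off a single node.\<close>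

lemma orthogonal_rsquarefree:
  fixes v c :: "'n::finite \<Rightarrow> real" and P :: "complex poly"
  assumes inj: "inj v" and pos: "\<And>l. c l > 0" and M: "M < CARD('n)"
    and orth: "orthogonal_to_lower v c M P" and "P \<noteq> 0" and deg: "degree P \<le> M"
  shows "rsquarefree P"
proof -
  have "order z P \<le> 1" for z
  proof (rule ccontr)
    assume "\<not> ?thesis"
    then have dvd: "[:-z, 1:] ^ 2 dvd P"
      using order_1[of z P] by (metis dvd_trans le_imp_power_dvd not_le Suc_1 Suc_leI One_nat_def)
    then obtain V where P: "P = [:-z, 1:] ^ 2 * V"
      by (auto simp: dvd_def)
    then have "V \<noteq> 0"
      using \<open>P \<noteq> 0\<close> by auto
    then have degV: "degree V + 2 \<le> M"
      using deg unfolding P by (subst (asm) degree_mult_eq) (auto simp: degree_power_eq)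
    have "poly P z = 0"
      by (simp add: P)
    then obtain x where z: "z = of_real x"
      using orthogonal_root_real(1)[OF assms] by (auto elim: Reals_cases)
    have "(\<Sum>l\<in>UNIV. of_real (c l) * poly P (of_real (v l)) * poly (map_poly cnj V) (of_real (v l))) = 0"
      using degV by (intro orthogonal_to_lowerD[OF orth]) simp
    moreover have "of_real (c l) * poly P (of_real (v l)) * poly (map_poly cnj V) (of_real (v l)) =
       complex_of_real (c l * (v l - x)\<^sup>2 * (cmod (poly V (v l)))\<^sup>2)" for l
      unfolding P z poly_map_poly_cnj_of_real of_real_mult complex_norm_square
      by (simp add: algebra_simps power2_eq_square)
    ultimately have "complex_of_real (\<Sum>l\<in>UNIV. c l * (v l - x)\<^sup>2 * (cmod (poly V (v l)))\<^sup>2) = 0"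
      by (simp only: of_real_sum)
    then have "(\<Sum>l\<in>UNIV. c l * (v l - x)\<^sup>2 * (cmod (poly V (v l)))\<^sup>2) = 0"
      by (simp only: of_real_eq_0_iff)
    then have "c l * (v l - x)\<^sup>2 * (cmod (poly V (v l)))\<^sup>2 = 0" for l
      using pos by (subst (asm) sum_nonneg_eq_0_iff) (auto simp: less_imp_le)
    then have "poly V (of_real (v l)) = 0" if "v l \<noteq> x" for l
      using that pos[of l] by (metis less_irrefl mult_eq_0_iff norm_eq_zero right_minus_eq zero_eq_power2)
    then have "V = 0"
      using poly_eq_0_if_almost_all_nodes[OF inj, of V x] degV M by auto
    then show False
      using \<open>V \<noteq> 0\<close> by simp
  qed
  then show ?thesis
    unfolding rsquarefree_def using \<open>P \<noteq> 0\<close> by (metis One_nat_def le_Suc_eq le_zero_eq)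
qed

lemma card_roots_rsquarefree:
  fixes P :: "complex poly"
  assumes "rsquarefree P"
  shows "card {z. poly P z = 0} = degree P"
proof -
  have "P \<noteq> 0" using assms by (simp add: rsquarefree_def)
  have "degree P = degree (smult (lead_coeff P) (\<Prod>z|poly P z = 0. [:-z, 1:]))"
    using complex_poly_decompose_rsquarefree[OF assms] by simp
  also have "\<dots> = card {z. poly P z = 0}"
    using \<open>P \<noteq> 0\<close> by (simp add: degree_prod_sum_eq)
  finally show ?thesis by simp
qed

text \<open>The conjugate of such a \<open>P\<close> is an admissible test and makes the sum a
  squared norm.\<close>

lemma orthogonal_lower_degree_eq_0:
  fixes v c :: "'n::finite \<Rightarrow> real" and P :: "complex poly"
  assumes inj: "inj v" and pos: "\<And>l. c l > 0" and M: "M < CARD('n)"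
    and orth: "orthogonal_to_lower v c M P" and deg: "degree P < M"
  shows "P = 0"
proof -
  have "(\<Sum>l\<in>UNIV. of_real (c l) * poly P (of_real (v l)) * poly (map_poly cnj P) (of_real (v l))) = 0"
    using deg by (intro orthogonal_to_lowerD[OF orth]) simp
  moreover have "of_real (c l) * poly P (of_real (v l)) * poly (map_poly cnj P) (of_real (v l)) =
     complex_of_real (c l * (cmod (poly P (v l)))\<^sup>2)" for l
    unfolding poly_map_poly_cnj_of_real of_real_mult complex_norm_square by (simp add: mult_ac)
  ultimately have "complex_of_real (\<Sum>l\<in>UNIV. c l * (cmod (poly P (v l)))\<^sup>2) = 0"
    by (simp only: of_real_sum)
  then have "(\<Sum>l\<in>UNIV. c l * (cmod (poly P (v l)))\<^sup>2) = 0"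
    by (simp only: of_real_eq_0_iff)
  then have "c l * (cmod (poly P (v l)))\<^sup>2 = 0" for l
    using pos by (subst (asm) sum_nonneg_eq_0_iff) (auto simp: less_imp_le)
  then have "poly P (of_real (v l)) = 0" for l
    using pos[of l] by (metis less_irrefl mult_eq_0_iff norm_eq_zero zero_eq_power2)
  then show ?thesis
    using poly_eq_0_if_almost_all_nodes[OF inj, of P] deg M by auto
qed

text \<open>Subtracting the multiple of \<open>P\<close> that cancels the coefficient at
  \<open>M\<close> leaves an orthogonal polynomial of lower degree, hence zero.\<close>

lemma orthogonal_proportional:
  fixes v c :: "'n::finite \<Rightarrow> real" and P Q :: "complex poly"
  assumes inj: "inj v" and pos: "\<And>l. c l > 0" and M: "M < CARD('n)"
    and P: "orthogonal_to_lower v c M P" "degree P = M" "lead_coeff P = 1"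
    and Q: "orthogonal_to_lower v c M Q" "degree Q \<le> M"
  shows "Q = smult (coeff Q M) P"
proof (cases "M = 0")
  case True
  with P Q show ?thesis
    by (auto elim!: degree_eq_zeroE)
next
  case False
  let ?R = "Q - smult (coeff Q M) P"
  have "degree ?R < M"
  proof (rule degree_lessI)
    show "\<forall>k\<ge>M. coeff ?R k = 0"
    proof (intro allI impI)
      fix k assume "k \<ge> M"
      then show "coeff ?R k = 0"
        using P(2,3) Q(2) by (cases "k = M") (simp_all add: coeff_eq_0)
    qed
  qed (use False in auto)
  moreover have "orthogonal_to_lower v c M ?R"
    unfolding orthogonal_to_lower_def
  proof (intro allI impI)
    fix T :: "complex poly" assume "degree T < M"
    then have "(\<Sum>l\<in>UNIV. of_real (c l) * poly P (of_real (v l)) * poly T (of_real (v l))) = 0"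
      "(\<Sum>l\<in>UNIV. of_real (c l) * poly Q (of_real (v l)) * poly T (of_real (v l))) = 0"
      using P(1) Q(1) by (auto simp: orthogonal_to_lower_def)
    moreover have "(\<Sum>l\<in>UNIV. of_real (c l) * poly ?R (of_real (v l)) * poly T (of_real (v l))) =
       (\<Sum>l\<in>UNIV. of_real (c l) * poly Q (of_real (v l)) * poly T (of_real (v l))) -
       coeff Q M * (\<Sum>l\<in>UNIV. of_real (c l) * poly P (of_real (v l)) * poly T (of_real (v l)))"
      by (simp add: sum_subtractf sum_distrib_left algebra_simps)
    ultimately show "(\<Sum>l\<in>UNIV. of_real (c l) * poly ?R (of_real (v l)) * poly T (of_real (v l))) = 0"
      by simp
  qed
  ultimately have "?R = 0"
    using orthogonal_lower_degree_eq_0[of v c M ?R, OF inj pos M] by blast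
  then show ?thesis by simp
qed

section \<open>Polynomials with a given coefficient vector\<close>

lemma index_degree_strict_mono: "strict_mono (index_degree :: 'm::{finite,linorder} \<Rightarrow> nat)"
  unfolding strict_mono_def index_degree_def
proof (intro allI impI)
  fix i k :: 'm assume "i < k"
  then have "{j. j < i} \<subset> {j. j < k}"
    by (auto intro: less_trans)
  then show "card {j. j < i} < card {j. j < k}"
    by (rule psubset_card_mono[rotated]) simp
qed

lemma bij_betw_index_degree:
  "bij_betw (index_degree :: 'm::{finite,linorder} \<Rightarrow> nat) UNIV {..<CARD('m)}"
proof -
  have inj: "inj (index_degree :: 'm \<Rightarrow> nat)"
    by (rule strict_mono_imp_inj_on[OF index_degree_strict_mono])
  have "index_degree k < CARD('m)" for k :: 'm
    unfolding index_degree_def by (rule psubset_card_mono) auto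
  then have "range (index_degree :: 'm \<Rightarrow> nat) \<subseteq> {..<CARD('m)}"
    by auto
  then have "range (index_degree :: 'm \<Rightarrow> nat) = {..<CARD('m)}"
    using inj by (intro card_subset_eq) (auto simp: card_image)
  then show ?thesis
    using inj by (simp add: bij_betw_def)
qed

lemma index_degree_less: "index_degree (k :: 'm::{finite,linorder}) < CARD('m)"
  using bij_betwE[OF bij_betw_index_degree] by auto

lemma index_degree_inj: "index_degree (k :: 'm::{finite,linorder}) = index_degree j \<longleftrightarrow> k = j"
  by (rule strict_mono_eq[OF index_degree_strict_mono])

lemma all_less_card_iff_index_degree:
  "(\<forall>j<CARD('m). Q j) \<longleftrightarrow> (\<forall>k::'m::{finite,linorder}. Q (index_degree k))"
proof -
  have "(\<forall>j\<in>{..<CARD('m)}. Q j) \<longleftrightarrow> (\<forall>j\<in>range (index_degree :: 'm \<Rightarrow> nat). Q j)"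
    using bij_betw_imp_surj_on[OF bij_betw_index_degree[where 'm = 'm]] by simp
  then show ?thesis by auto
qed

text \<open>Advancing to the next moment index multiplies the monomial by the velocity, as the flux
  components other than the last require.\<close>

lemma index_degree_next:
  fixes k :: "'m::{finite,linorder}"
  assumes "\<exists>j. k < j"
  shows "index_degree (LEAST j. k < j) = Suc (index_degree k)"
proof -
  have "(LEAST j. k < j) = Min {j. k < j}"
    using assms by (intro Least_Min) auto
  moreover have "i < Min {j. k < j} \<longleftrightarrow> i \<le> k" for i
  proof -
    have "i < Min {j. k < j} \<longleftrightarrow> (\<forall>j\<in>{j. k < j}. i < j)"
      using assms by (intro Min_gr_iff) auto
    also have "\<dots> \<longleftrightarrow> i \<le> k"
    proof
      assume less: "\<forall>j\<in>{j. k < j}. i < j"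
      show "i \<le> k"
        using less[rule_format, of i] by (cases "k < i") auto
    next
      assume "i \<le> k"
      then show "\<forall>j\<in>{j. k < j}. i < j"
        by (auto intro: le_less_trans)
    qed
    finally show ?thesis .
  qed
  then have "{i. i < Min {j. k < j}} = {i. i \<le> k}"
    by (simp only:)
  then have "{i. i < Min {j. k < j}} = insert k {i. i < k}"
    by (simp only: order_le_less) auto
  ultimately show ?thesis
    by (simp add: index_degree_def)
qed

text \<open>The last index carries exponent M - 1, so one more factor of the velocity gives the
  predicted moment.\<close>

lemma index_degree_last:
  fixes k :: "'m::{finite,linorder}"
  assumes "\<not> (\<exists>j. k < j)"
  shows "CARD('m) = Suc (index_degree k)"
proof -
  have "UNIV = insert k {i. i < k}"
    using assms by (auto simp: not_less order_le_less)
  then have "CARD('m) = card (insert k {i. i < k})"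
    by simp
  then show ?thesis
    by (simp add: index_degree_def)
qed

text \<open>Identifies coefficient vectors with polynomials of degree below M (see
  \<open>vec_poly_surj\<close>), which translates matrix kernels into polynomial statements.\<close>

definition vec_poly :: "'a::comm_ring_1^'m::{finite,linorder} \<Rightarrow> 'a poly" where
  "vec_poly u = (\<Sum>k\<in>UNIV. monom (u $ k) (index_degree k))"

lemma poly_vec_poly: "poly (vec_poly u) x = (\<Sum>k\<in>UNIV. u $ k * x ^ index_degree k)"
  by (simp add: vec_poly_def poly_sum poly_monom)

lemma coeff_vec_poly [simp]: "coeff (vec_poly u) (index_degree k) = u $ k"
  by (simp add: vec_poly_def coeff_sum index_degree_inj)

lemma degree_vec_poly: "degree (vec_poly (u :: 'a::comm_ring_1^'m::{finite,linorder})) < CARD('m)"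
  unfolding vec_poly_def
  by (rule degree_sum_less) (auto intro: le_less_trans[OF degree_monom_le] index_degree_less)

lemma vec_poly_eq_0_iff: "vec_poly u = 0 \<longleftrightarrow> u = 0"
proof
  assume "vec_poly u = 0"
  then have "u $ k = 0" for k
    using coeff_vec_poly[of u k] by simp
  then show "u = 0" by (simp add: vec_eq_iff)
qed (simp add: vec_poly_def)

lemma vec_poly_surj:
  fixes U :: "'a::comm_ring_1 poly"
  assumes "degree U < CARD('m::{finite,linorder})"
  obtains u :: "'a^'m::{finite,linorder}" where "U = vec_poly u"
proof
  let ?u = "(\<chi> k. coeff U (index_degree k)) :: 'a^'m::{finite,linorder}"
  show "U = vec_poly ?u"
  proof (rule poly_eqI)
    fix n show "coeff U n = coeff (vec_poly ?u) n"
    proof (cases "n < CARD('m)")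
      case True
      then obtain k :: 'm where "n = index_degree k"
        using bij_betw_imp_surj_on[OF bij_betw_index_degree[where 'm = 'm]] by (metis imageE lessThan_iff)
      then show ?thesis by simp
    next
      case False
      then show ?thesis
        using assms degree_vec_poly[of ?u] by (simp add: coeff_eq_0)
    qed
  qed
qed

lemma poly_vec_poly_real: "poly (vec_poly u) x = u \<bullet> pvec x"
  by (simp add: poly_vec_poly pvec_def inner_vec_def)

section \<open>Matrices\<close>

lemma matrix_inv_cancel:
  fixes A :: "real^'k^'k"
  assumes "invertible A"
  shows "A ** matrix_inv A = mat 1" and "matrix_inv A ** A = mat 1"
  using someI_ex[OF assms[unfolded invertible_def]] by (simp_all add: matrix_inv_def)

lemma sym_pos_def_invertible:
  assumes "sym_pos_def A"
  shows "invertible A"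
proof -
  have "x = 0" if "A *v x = 0" for x
    using assms that unfolding sym_pos_def_def by force
  then show ?thesis
    by (simp add: invertible_left_inverse matrix_left_invertible_ker)
qed

lemma sym_pos_def_matrix_inv:
  assumes A: "sym_pos_def A"
  shows "sym_pos_def (matrix_inv A)"
proof -
  note inv = matrix_inv_cancel[OF sym_pos_def_invertible[OF A]]
  have sym: "transpose A = A"
    using A by (simp add: sym_pos_def_def sym_matrix_def)
  have "transpose (matrix_inv A) = transpose (matrix_inv A) ** (A ** matrix_inv A)"
    by (simp add: inv)
  also have "\<dots> = transpose (A ** matrix_inv A) ** matrix_inv A"
    by (simp add: matrix_mul_assoc matrix_transpose_mul sym)
  also have "\<dots> = matrix_inv A"
    by (simp add: inv)
  finally have "sym_matrix (matrix_inv A)"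
    by (simp add: sym_matrix_def)
  moreover have "x \<bullet> (matrix_inv A *v x) > 0" if "x \<noteq> 0" for x
  proof -
    let ?u = "matrix_inv A *v x"
    \<comment> \<open>The form of the inverse at \<open>x\<close> is the form of \<open>A\<close> at
      \<open>?u\<close>.\<close>
    have x: "x = A *v ?u"
      by (simp add: matrix_vector_mul_assoc inv)
    then have "?u \<noteq> 0"
      using that by (metis matrix_vector_mult_0_right)
    then have "?u \<bullet> (A *v ?u) > 0"
      using A by (auto simp: sym_pos_def_def)
    then show ?thesis
      using x by (simp add: inner_commute)
  qed
  ultimately show ?thesis
    by (simp add: sym_pos_def_def)
qed

lemma jacobian_eqI:
  fixes A :: "real^'k^'j"
  assumes "(f has_derivative (\<lambda>h. A *v h)) (at x)"
  shows "jacobian f (at x) = A"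
  by (simp add: jacobian_def frechet_derivative_at[OF assms, symmetric])

lemma inner_transpose_mult: "h \<bullet> (transpose A *v x) = (A *v h) \<bullet> (x :: real^'k)"
  by (metis dot_lmul_matrix inner_commute transpose_matrix_vector)

lemma map_matrix_of_real_mult:
  fixes A :: "real^'k^'j" and B :: "real^'i^'k"
  shows "map_matrix complex_of_real (A ** B) = map_matrix complex_of_real A ** map_matrix complex_of_real B"
  by (simp add: vec_eq_iff matrix_matrix_mult_def)

lemma map_matrix_of_real_mat_1: "map_matrix complex_of_real (mat 1) = mat 1"
  by (simp add: vec_eq_iff mat_def)

section \<open>Gram matrices of discrete measures\<close>

text \<open>The weights are arbitrary: positive \<open>c l\<close> gives \<open>gram_H\<close>,
  while \<open>v $ l * c l\<close>, of any sign, gives \<open>gram_K\<close>.\<close>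

definition gram :: "real^'n \<Rightarrow> ('n::finite \<Rightarrow> real) \<Rightarrow> real^'m::{finite,linorder}^'m::{finite,linorder}" where
  "gram v c = (\<chi> i j. \<Sum>l\<in>UNIV. c l * pvec (v $ l) $ i * pvec (v $ l) $ j)"

lemma gram_mult: "gram v c *v x = (\<Sum>l\<in>UNIV. (c l * (x \<bullet> pvec (v $ l))) *\<^sub>R pvec (v $ l))"
proof -
  have "(gram v c *v x) $ i = (\<Sum>j\<in>UNIV. \<Sum>l\<in>UNIV. c l * pvec (v $ l) $ i * pvec (v $ l) $ j * x $ j)" for i
    by (simp add: gram_def matrix_vector_mult_def sum_distrib_right)
  also have "\<dots> i = (\<Sum>l\<in>UNIV. c l * (x \<bullet> pvec (v $ l)) * pvec (v $ l) $ i)" for i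
    by (subst sum.swap) (simp add: inner_vec_def sum_distrib_left sum_distrib_right mult_ac)
  finally show ?thesis
    by (simp add: vec_eq_iff)
qed

lemma sym_matrix_gram: "sym_matrix (gram v c)"
  by (simp add: sym_matrix_def gram_def transpose_def vec_eq_iff mult_ac)

text \<open>Read as a polynomial of degree below M, such an \<open>x\<close> has N > M zeros. This
  yields definiteness of Gram matrices, uniqueness of the dual minimizer and coercivity.\<close>

lemma pvec_total:
  fixes v :: "real^'n" and x :: "real^'m::{finite,linorder}"
  assumes "inj (($) v)" "CARD('m) < CARD('n)" "\<And>l. x \<bullet> pvec (v $ l) = 0"
  shows "x = 0"
proof -
  have "vec_poly x = 0"
    using assms degree_vec_poly[of x]
    by (intro poly_eq_0_if_almost_all_nodes[of "($) v"]) (auto simp: poly_vec_poly_real)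
  then show ?thesis
    by (simp add: vec_poly_eq_0_iff)
qed

lemma sym_pos_def_gram:
  fixes v :: "real^'n"
  assumes inj: "inj (($) v)" and card: "CARD('m) < CARD('n)" and pos: "\<And>l. c l > 0"
  shows "sym_pos_def (gram v c :: real^'m::{finite,linorder}^'m::{finite,linorder})"
proof -
  have "x \<bullet> (gram v c *v x) > 0" if "x \<noteq> 0" for x :: "real^'m::{finite,linorder}"
  proof -
    have eq: "x \<bullet> (gram v c *v x) = (\<Sum>l\<in>UNIV. c l * (x \<bullet> pvec (v $ l))\<^sup>2)"
      by (simp add: gram_mult inner_sum_right power2_eq_square mult_ac)
    obtain l where "x \<bullet> pvec (v $ l) \<noteq> 0"
      using pvec_total[OF inj card] \<open>x \<noteq> 0\<close> by blast
    then show ?thesis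
      unfolding eq using pos by (intro sum_pos2[of UNIV l]) (auto simp: less_imp_le)
  qed
  then show ?thesis
    by (simp add: sym_pos_def_def sym_matrix_gram)
qed

text \<open>The witness is \<open>X^M\<close> minus its projection onto lower degrees; definiteness
  of the Gram matrix solves the normal equations.\<close>

lemma ex_monic_orthogonal:
  fixes v :: "real^'n"
  assumes inj: "inj (($) v)" and card: "CARD('m::{finite,linorder}) < CARD('n)" and pos: "\<And>l. c l > 0"
  shows "\<exists>P :: real poly. degree P = CARD('m) \<and> lead_coeff P = 1 \<and> orthogonal_to_lower (($) v) c CARD('m) P"
proof -
  let ?G = "gram v c :: real^'m::{finite,linorder}^'m::{finite,linorder}"
  \<comment> \<open>The products of \<open>X^M\<close> with the lower monomials: the right side of
    the normal equations.\<close>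
  define b :: "real^'m::{finite,linorder}" where "b = (\<Sum>l\<in>UNIV. (c l * v $ l ^ CARD('m)) *\<^sub>R pvec (v $ l))"
  define u where "u = matrix_inv ?G *v b"
  have Gu: "?G *v u = b"
    using matrix_inv_cancel[OF sym_pos_def_invertible[OF sym_pos_def_gram[OF inj card pos]]]
    by (simp add: u_def matrix_vector_mul_assoc)
  let ?P = "monom 1 CARD('m) - vec_poly u"
  have deg: "degree ?P = CARD('m)"
    using degree_vec_poly[of u]
    by (subst diff_conv_add_uminus, subst degree_add_eq_left) (auto simp: degree_monom_eq)
  moreover have "lead_coeff ?P = 1"
    unfolding deg using degree_vec_poly[of u] by (simp add: coeff_eq_0)
  moreover have "orthogonal_to_lower (($) v) c CARD('m) ?P"
    unfolding orthogonal_to_lower_iff_monomials all_less_card_iff_index_degree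
  proof
    fix k :: 'm
    have "(\<Sum>l\<in>UNIV. c l * poly ?P (v $ l) * v $ l ^ index_degree k) = (b - ?G *v u) $ k"
      by (simp add: poly_monom poly_vec_poly_real gram_mult b_def pvec_def algebra_simps
          sum_subtractf)
    then show "(\<Sum>l\<in>UNIV. of_real (c l) * poly ?P (of_real (v $ l)) * of_real (v $ l) ^ index_degree k) = 0"
      by (simp add: Gu)
  qed
  ultimately show ?thesis by blast
qed

text \<open>The pencil \<open>K - z H\<close> of the Gram matrices acts on coefficient vectors as multiplication of
  polynomials by \<open>X - z\<close> followed by taking moments.\<close>

lemma gram_pencil_kernel_iff:
  fixes u :: "complex^'m::{finite,linorder}" and v :: "real^'n"
  shows "map_matrix complex_of_real (gram v (\<lambda>l. v $ l * c l)) *v u =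
      z *s (map_matrix complex_of_real (gram v c) *v u) \<longleftrightarrow>
    orthogonal_to_lower (($) v) c CARD('m) ([:-z, 1:] * vec_poly u)"
proof -
  have aux: "a = b \<longleftrightarrow> s = 0" if "a - b = s" for a b s :: complex
    using that by auto
  have gram: "(map_matrix complex_of_real (gram v d) *v u) $ k =
      (\<Sum>l\<in>UNIV. of_real (d l) * poly (vec_poly u) (of_real (v $ l)) * of_real (v $ l) ^ index_degree k)"
    for d :: "'n \<Rightarrow> real" and k :: 'm
  proof -
    have "(map_matrix complex_of_real (gram v d) *v u) $ k =
       (\<Sum>j\<in>UNIV. \<Sum>l\<in>UNIV. of_real (d l) * of_real (v $ l) ^ index_degree k *
          of_real (v $ l) ^ index_degree j * u $ j)"
      by (simp add: gram_def matrix_vector_mult_def sum_distrib_right pvec_def)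
    also have "\<dots> = (\<Sum>l\<in>UNIV. of_real (d l) * poly (vec_poly u) (of_real (v $ l)) * of_real (v $ l) ^ index_degree k)"
      by (subst sum.swap) (simp add: poly_vec_poly sum_distrib_left sum_distrib_right mult_ac)
    finally show ?thesis .
  qed
  have "(map_matrix complex_of_real (gram v (\<lambda>l. v $ l * c l)) *v u) $ k -
      (z *s (map_matrix complex_of_real (gram v c) *v u)) $ k =
      (\<Sum>l\<in>UNIV. of_real (c l) * poly ([:-z, 1:] * vec_poly u) (of_real (v $ l)) * of_real (v $ l) ^ index_degree k)"
    for k
    unfolding vector_smult_component gram sum_distrib_left sum_subtractf[symmetric]
    by (intro sum.cong refl) (simp add: algebra_simps)
  then have "(map_matrix complex_of_real (gram v (\<lambda>l. v $ l * c l)) *v u) $ k =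
      (z *s (map_matrix complex_of_real (gram v c) *v u)) $ k \<longleftrightarrow>
      (\<Sum>l\<in>UNIV. of_real (c l) * poly ([:-z, 1:] * vec_poly u) (of_real (v $ l)) * of_real (v $ l) ^ index_degree k) = 0"
    for k
    by (rule aux)
  then show ?thesis
    unfolding orthogonal_to_lower_iff_monomials all_less_card_iff_index_degree vec_eq_iff by simp
qed

text \<open>The substitution \<open>x = H u\<close> turns the eigenvalue equation into the kernel
  equation of the pencil. Eigenvectors thus correspond, up to scalars, to the cofactors of
  \<open>X - z\<close> in \<open>P\<close>.\<close>

lemma eigenvals_gram:
  fixes v :: "real^'n" and c :: "'n \<Rightarrow> real" and P :: "real poly"
  defines "H \<equiv> gram v c :: real^'m::{finite,linorder}^'m::{finite,linorder}"
    and "K \<equiv> gram v (\<lambda>l. v $ l * c l) :: real^'m::{finite,linorder}^'m::{finite,linorder}"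
  assumes inj: "inj (($) v)" and card: "CARD('m) < CARD('n)" and pos: "\<And>l. c l > 0"
    and P: "degree P = CARD('m)" "lead_coeff P = 1" "orthogonal_to_lower (($) v) c CARD('m) P"
  shows "eigenvals (K ** matrix_inv H) = {z. poly (map_poly of_real P) z = 0}"
proof -
  let ?c = "map_matrix complex_of_real"
  let ?P = "map_poly of_real P :: complex poly"
  have degP: "degree ?P = CARD('m)" "lead_coeff ?P = 1"
    using P(1,2) by (simp_all add: degree_map_poly coeff_map_poly)
  have orthP: "orthogonal_to_lower (($) v) c CARD('m) ?P"
    using P(3) by (simp add: orthogonal_to_lower_of_real)
  note inv = matrix_inv_cancel[OF sym_pos_def_invertible[OF sym_pos_def_gram[OF inj card pos]]]
  have cinv: "?c H ** ?c (matrix_inv H) = mat 1" "?c (matrix_inv H) ** ?c H = mat 1"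
    unfolding map_matrix_of_real_mult[symmetric] H_def inv by (rule map_matrix_of_real_mat_1)+
  have deg_le: "degree ([:-z, 1:] * vec_poly u) \<le> CARD('m)" for z and u :: "complex^'m::{finite,linorder}"
    using degree_mult_le[of "[:-z, 1:]" "vec_poly u"] degree_vec_poly[of u] by simp
  show ?thesis
  proof (intro set_eqI iffI)
    fix z assume "z \<in> eigenvals (K ** matrix_inv H)"
    then obtain x where x: "x \<noteq> 0" "?c (K ** matrix_inv H) *v x = z *s x"
      by (auto simp: eigenvals_def)
    define u where "u = ?c (matrix_inv H) *v x"
    have Hu: "?c H *v u = x"
      by (simp add: u_def matrix_vector_mul_assoc cinv)
    then have "u \<noteq> 0"
      using x(1) by auto
    have "?c K *v u = z *s (?c H *v u)"
      unfolding Hu using x(2) by (simp add: u_def map_matrix_of_real_mult matrix_vector_mul_assoc)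
    then have "orthogonal_to_lower (($) v) c CARD('m) ([:-z, 1:] * vec_poly u)"
      unfolding H_def K_def gram_pencil_kernel_iff .
    then have eq: "[:-z, 1:] * vec_poly u = smult (coeff ([:-z, 1:] * vec_poly u) CARD('m)) ?P"
      by (rule orthogonal_proportional[OF inj pos card orthP degP _ deg_le])
    define a where "a = coeff ([:-z, 1:] * vec_poly u) CARD('m)"
    \<comment> \<open>A nonzero product makes the factor \<open>a\<close> nonzero, so the zero at
      \<open>z\<close> passes to \<open>P\<close>.\<close>
    have "[:-z, 1:] * vec_poly u \<noteq> 0"
      using \<open>u \<noteq> 0\<close> by (simp add: vec_poly_eq_0_iff del: mult_pCons_left)
    then have "a \<noteq> 0"
      using eq unfolding a_def[symmetric] by auto
    moreover have "a * poly ?P z = poly ([:-z, 1:] * vec_poly u) z"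
      using eq unfolding a_def[symmetric] by (metis poly_smult)
    moreover have "poly ([:-z, 1:] * vec_poly u) z = 0"
      by simp
    ultimately show "z \<in> {z. poly ?P z = 0}"
      by simp
  next
    fix z assume "z \<in> {z. poly ?P z = 0}"
    \<comment> \<open>The cofactor of the root supplies a coefficient vector; its image under
      \<open>H\<close> is the eigenvector.\<close>
    then obtain U where U: "?P = [:-z, 1:] * U"
      by (auto simp: poly_eq_0_iff_dvd)
    have "?P \<noteq> 0"
      using degP by auto
    then have "U \<noteq> 0"
      using U by auto
    then have "degree U < CARD('m)"
      using degP(1) unfolding U by (subst (asm) degree_mult_eq) auto
    then obtain u :: "complex^'m::{finite,linorder}" where u: "U = vec_poly u"
      by (rule vec_poly_surj)
    have "u \<noteq> 0"
      using \<open>U \<noteq> 0\<close> by (simp add: u vec_poly_eq_0_iff)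
    define x where "x = ?c H *v u"
    have ux: "u = ?c (matrix_inv H) *v x"
      by (simp add: x_def matrix_vector_mul_assoc cinv)
    then have "x \<noteq> 0"
      using \<open>u \<noteq> 0\<close> by auto
    have "?c K *v u = z *s x"
      unfolding x_def H_def K_def gram_pencil_kernel_iff using orthP by (simp add: U u)
    then have "?c (K ** matrix_inv H) *v x = z *s x"
      by (simp add: ux map_matrix_of_real_mult matrix_vector_mul_assoc[symmetric])
    then show "z \<in> eigenvals (K ** matrix_inv H)"
      using \<open>x \<noteq> 0\<close> by (auto simp: eigenvals_def)
  qed
qed

section \<open>Gauss nodes of discrete measures\<close>

lemma poly_map_poly_of_real_roots:
  fixes P :: "real poly"
  assumes "{z :: complex. poly (map_poly of_real P) z = 0} \<subseteq> \<real>"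
  shows "{z :: complex. poly (map_poly of_real P) z = 0} = of_real ` {x. poly P x = 0}"
  using assms by (auto simp: poly_map_poly_of_real elim!: Reals_cases)

lemma ex_strict_mono_enumeration:
  fixes S :: "real set"
  assumes "finite S" "card S = CARD('m::{finite,linorder})"
  shows "\<exists>\<theta> :: 'm \<Rightarrow> real. strict_mono \<theta> \<and> range \<theta> = S"
proof (intro exI conjI)
  let ?xs = "sorted_list_of_set S"
  let ?\<theta> = "\<lambda>k :: 'm. ?xs ! index_degree k"
  have len: "length ?xs = CARD('m)"
    using assms by simp
  show "strict_mono ?\<theta>"
  proof (rule strict_monoI)
    fix i k :: 'm assume "i < k"
    then have "index_degree i < index_degree k"
      using index_degree_strict_mono by (auto simp: strict_mono_def)
    then show "?\<theta> i < ?\<theta> k"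
      using sorted_wrt_nth_less[OF strict_sorted_list_of_set[of S]] index_degree_less[of k] len by simp
  qed
  have "range ?\<theta> = (!) ?xs ` range (index_degree :: 'm \<Rightarrow> nat)"
    by auto
  also have "\<dots> = (!) ?xs ` {..<length ?xs}"
    by (simp only: len bij_betw_imp_surj_on[OF bij_betw_index_degree])
  also have "\<dots> = set ?xs"
    by (auto simp: set_conv_nth)
  finally show "range ?\<theta> = S"
    using assms by simp
qed

text \<open>Finitely many indices make the products integrable, and change of variables turns the
  integrals into sums over the nodes.\<close>

lemma monic_orthogonal_poly_discrete:
  fixes v :: "'n::finite \<Rightarrow> real"
  assumes "\<And>l. c l > 0"
  defines "\<mu> \<equiv> distr (density (count_space UNIV) (\<lambda>l. ennreal (c l))) borel v"
  shows "monic_orthogonal_poly \<mu> n P \<longleftrightarrow>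
    degree P = n \<and> lead_coeff P = 1 \<and> orthogonal_to_lower v c n P"
proof -
  have meas: "(\<lambda>x. poly P x * poly Q x) \<in> borel_measurable borel" for Q :: "real poly"
    by (intro borel_measurable_continuous_onI continuous_intros)
  have v: "v \<in> measurable (density (count_space UNIV) (\<lambda>l. ennreal (c l))) borel"
    by simp
  have "integrable \<mu> (\<lambda>x. poly P x * poly Q x)" for Q
    unfolding \<mu>_def integrable_distr_eq[OF v meas]
    using assms(1) by (subst integrable_density) (auto simp: integrable_count_space less_imp_le)
  moreover have "(\<integral>x. poly P x * poly Q x \<partial>\<mu>) = (\<Sum>l\<in>UNIV. c l * poly P (v l) * poly Q (v l))" for Q
    unfolding \<mu>_def integral_distr[OF v meas]
    using assms(1) by (subst integral_density)
      (auto simp: lebesgue_integral_count_space_finite less_imp_le mult_ac)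
  ultimately show ?thesis
    by (simp add: monic_orthogonal_poly_def orthogonal_to_lower_def)
qed

text \<open>Evaluating the definite description needs uniqueness, inherited from
  \<open>orthogonal_proportional\<close> because the embedding into the complex numbers is injective
  on coefficients.\<close>

lemma gauss_nodes_discrete:
  fixes v :: "'n::finite \<Rightarrow> real"
  assumes inj: "inj v" and pos: "\<And>l. c l > 0" and n: "n < CARD('n)"
    and P: "degree P = n" "lead_coeff P = 1" "orthogonal_to_lower v c n P"
  shows "gauss_nodes (distr (density (count_space UNIV) (\<lambda>l. ennreal (c l))) borel v) n = {x. poly P x = 0}"
proof -
  have uniq: "Q = P" if Q: "degree Q = n" "lead_coeff Q = 1" "orthogonal_to_lower v c n Q" for Q
  proof -
    let ?c = "map_poly of_real :: real poly \<Rightarrow> complex poly"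
    have "?c Q = smult (coeff (?c Q) n) (?c P)"
      using P Q by (intro orthogonal_proportional[OF inj pos n])
        (simp_all add: orthogonal_to_lower_of_real degree_map_poly coeff_map_poly)
    moreover have "coeff (?c Q) n = 1"
      using Q by (simp add: coeff_map_poly)
    ultimately have "?c Q = ?c P"
      by (metis smult_1_left)
    then have "coeff (?c Q) i = coeff (?c P) i" for i
      by simp
    then show ?thesis
      by (simp add: poly_eq_iff coeff_map_poly)
  qed
  have "(THE P. monic_orthogonal_poly (distr (density (count_space UNIV) (\<lambda>l. ennreal (c l))) borel v) n P) = P"
    unfolding monic_orthogonal_poly_discrete[OF pos] using P uniq by (intro the_equality) blast+
  then show ?thesis
    by (simp add: gauss_nodes_def)
qed

lemma eigenvals_gram_gauss_nodes:
  fixes v :: "real^'n::{finite,linorder}" and c :: "'n \<Rightarrow> real"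
  defines "J \<equiv> gram v (\<lambda>l. v $ l * c l) ** matrix_inv (gram v c) :: real^'m::{finite,linorder}^'m::{finite,linorder}"
  assumes mono: "strict_mono (($) v)" and card: "CARD('m) < CARD('n)" and pos: "\<And>l. c l > 0"
  shows "eigenvals J \<subseteq> \<real>" and "card (eigenvals J) = CARD('m)"
    and "\<exists>\<theta> :: 'm \<Rightarrow> real. strict_mono \<theta> \<and>
      range \<theta> = gauss_nodes (distr (density (count_space UNIV) (\<lambda>l. ennreal (c l))) borel (($) v)) CARD('m) \<and>
      eigenvals J = complex_of_real ` range \<theta> \<and>
      (\<forall>k. v $ Min UNIV < \<theta> k \<and> \<theta> k < v $ Max UNIV)"
proof -
  have inj: "inj (($) v)"
    by (rule strict_mono_imp_inj_on[OF mono])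
  obtain P :: "real poly" where P: "degree P = CARD('m)" "lead_coeff P = 1"
    "orthogonal_to_lower (($) v) c CARD('m) P"
    using ex_monic_orthogonal[where c = c, OF inj card pos] by blast
  let ?P = "map_poly of_real P :: complex poly"
  have cP: "orthogonal_to_lower (($) v) c CARD('m) ?P" "?P \<noteq> 0" "degree ?P \<le> CARD('m)"
  proof -
    show "orthogonal_to_lower (($) v) c CARD('m) ?P"
      using P(3) by (simp only: orthogonal_to_lower_of_real)
    have "degree ?P = CARD('m)" "lead_coeff ?P = 1"
      using P(1,2) by (simp_all add: degree_map_poly coeff_map_poly)
    then show "?P \<noteq> 0" "degree ?P \<le> CARD('m)"
      by auto
  qed
  have eig: "eigenvals J = {z. poly ?P z = 0}"
    unfolding J_def by (rule eigenvals_gram[where c = c, OF inj card pos P])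
  note real = orthogonal_root_real[where c = c, OF inj pos card cP]
  show sub: "eigenvals J \<subseteq> \<real>"
    unfolding eig by (intro subsetI real(1)) simp
  show card_eig: "card (eigenvals J) = CARD('m)"
    unfolding eig card_roots_rsquarefree[OF orthogonal_rsquarefree[where c = c, OF inj pos card cP]]
    using P(1) by (simp add: degree_map_poly)
  have eigP: "eigenvals J = of_real ` {x. poly P x = 0}"
    using sub unfolding eig by (rule poly_map_poly_of_real_roots)
  have fin: "finite {x. poly P x = 0}"
    using P by (intro poly_roots_finite) auto
  \<comment> \<open>The complex zeros are M in number and all real, so counting them counts the real
    zeros.\<close>
  have "card {x. poly P x = 0} = CARD('m)"
    using card_eig unfolding eigP by (subst (asm) card_image) (auto simp: inj_on_def)
  then obtain \<theta> :: "'m \<Rightarrow> real" where \<theta>: "strict_mono \<theta>" "range \<theta> = {x. poly P x = 0}"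
    using ex_strict_mono_enumeration[OF fin] by blast
  have bounds: "v $ Min UNIV < \<theta> k \<and> \<theta> k < v $ Max UNIV" for k
  proof -
    have "poly P (\<theta> k) = 0"
      using \<theta>(2) by blast
    then have "poly ?P (of_real (\<theta> k)) = 0"
      by (simp add: poly_map_poly_of_real)
    from real(2,3)[OF this] obtain l l' where "v $ l < \<theta> k" "\<theta> k < v $ l'"
      by auto
    \<comment> \<open>The root lemma only yields some node on each side; monotonicity replaces it by
      the extreme one.\<close>
    moreover have "v $ Min UNIV \<le> v $ l" "v $ l' \<le> v $ Max UNIV"
      by (intro monoD[OF strict_mono_mono[OF mono]] Min_le Max_ge finite UNIV_I)+
    ultimately show ?thesis by linarith
  qed
  show "\<exists>\<theta> :: 'm \<Rightarrow> real. strict_mono \<theta> \<and>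
      range \<theta> = gauss_nodes (distr (density (count_space UNIV) (\<lambda>l. ennreal (c l))) borel (($) v)) CARD('m) \<and>
      eigenvals J = complex_of_real ` range \<theta> \<and>
      (\<forall>k. v $ Min UNIV < \<theta> k \<and> \<theta> k < v $ Max UNIV)"
  proof (intro exI conjI)
    show "strict_mono \<theta>" by (rule \<theta>(1))
    show "range \<theta> = gauss_nodes (distr (density (count_space UNIV) (\<lambda>l. ennreal (c l))) borel (($) v)) CARD('m)"
      unfolding \<theta>(2) gauss_nodes_discrete[where c = c, OF inj pos card P] ..
    show "eigenvals J = complex_of_real ` range \<theta>"
      unfolding \<theta>(2) by (rule eigP)
    show "\<forall>k. v $ Min UNIV < \<theta> k \<and> \<theta> k < v $ Max UNIV"
      using bounds by blast
  qed
qed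

section \<open>Convex analysis\<close>

text \<open>Apply the supporting inequality at the intermediate point \<open>z\<close> to both
  endpoints; the weighted slope terms cancel since \<open>z\<close> is the weighted mean.\<close>

lemma strictly_convex_onI_gradient:
  fixes f :: "'a::real_inner \<Rightarrow> real"
  assumes "convex S"
    and grad: "\<And>x y. x \<in> S \<Longrightarrow> y \<in> S \<Longrightarrow> x \<noteq> y \<Longrightarrow> f x + G x \<bullet> (y - x) < f y"
  shows "strictly_convex_on S f"
  unfolding strictly_convex_on_def
proof (intro conjI ballI allI impI)
  fix x y :: 'a and a b :: real
  assume S: "x \<in> S" "y \<in> S" and ab: "a > 0" "b > 0" "a + b = 1" and "x \<noteq> y"
  define z where "z = a *\<^sub>R x + b *\<^sub>R y"
  have z: "z \<in> S"
    using \<open>convex S\<close> S ab by (simp add: z_def convex_def)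
  have b: "b = 1 - a"
    using ab by simp
  have zx: "x - z = b *\<^sub>R (x - y)" and zy: "y - z = (-a) *\<^sub>R (x - y)"
    by (simp_all add: z_def b algebra_simps)
  have "z \<noteq> x" "z \<noteq> y"
    using zx zy ab \<open>x \<noteq> y\<close> by auto
  then have "a * (f z + G z \<bullet> (x - z)) < a * f x" "b * (f z + G z \<bullet> (y - z)) < b * f y"
    using grad[OF z S(1)] grad[OF z S(2)] ab by simp_all
  moreover have "a * (f z + G z \<bullet> (x - z)) + b * (f z + G z \<bullet> (y - z)) = (a + b) * f z"
    unfolding zx zy by (simp add: algebra_simps)
  ultimately have "(a + b) * f z < a * f x + b * f y"
    by linarith
  then show "f (a *\<^sub>R x + b *\<^sub>R y) < a * f x + b * f y"
    using ab by (simp add: z_def)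
qed (rule assms(1))

text \<open>Strict minimality gives existence and uniqueness at once.\<close>

lemma the_is_arg_min:
  fixes f :: "'a \<Rightarrow> 'b::linorder"
  assumes "P x" and min: "\<And>z. P z \<Longrightarrow> z \<noteq> x \<Longrightarrow> f x < f z"
  shows "(THE z. is_arg_min f P z) = x"
proof (rule the_equality)
  have "\<not> f z < f x" if "P z" for z
    using min[OF that] by (cases "z = x") auto
  then show "is_arg_min f P x"
    using \<open>P x\<close> by (auto simp: is_arg_min_def)
  show "z = x" if "is_arg_min f P z" for z
    using that \<open>P x\<close> min unfolding is_arg_min_def by blast
qed

lemma xlnx_above_tangent:
  fixes a b :: real
  assumes "a > 0" "b \<ge> 0" "b \<noteq> a"
  shows "a * ln a + (ln a + 1) * (b - a) < b * ln b"
proof (cases "b = 0")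
  \<comment> \<open>Covers primal competitors on the boundary; the tangent at \<open>a\<close> takes
    the value \<open>-a\<close> at 0.\<close>
  case True
  then show ?thesis using \<open>a > 0\<close> by (simp add: algebra_simps)
next
  case False
  then have "b > 0" using assms by simp
  \<comment> \<open>The strict inequality \<open>ln t < t - 1\<close> at \<open>t = a / b\<close>,
    multiplied by \<open>b\<close>, is the claim rearranged.\<close>
  have "ln (a / b) \<le> a / b - 1" "ln (a / b) \<noteq> a / b - 1"
    using ln_le_minus_one[of "a / b"] ln_eq_minus_one[of "a / b"] assms \<open>b > 0\<close> by auto
  then have "b * ln (a / b) < b * (a / b - 1)"
    using \<open>b > 0\<close> by simp
  then show ?thesis
    using assms \<open>b > 0\<close> by (simp add: ln_div algebra_simps)
qed

lemma exp_gt_tangent: "x \<noteq> 0 \<Longrightarrow> 1 + x < exp (x :: real)"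
proof -
  assume "x \<noteq> 0"
  have "exp x \<noteq> 1 + x"
  proof
    assume "exp x = 1 + x"
    then have "ln (exp x) = exp x - 1"
      unfolding ln_exp by simp
    then have "exp x = 1"
      by (rule ln_eq_minus_one[OF exp_gt_zero])
    then show False
      using \<open>x \<noteq> 0\<close> by simp
  qed
  then show "1 + x < exp x"
    using exp_ge_add_one_self[of x] by linarith
qed

lemma linear_plus_exp_coercive:
  fixes f e :: real
  assumes "f > 0" "e > 0"
  shows "\<exists>B. \<forall>t. f * \<bar>t\<bar> - B \<le> f * t + e * exp (- t)"
proof (intro exI allI)
  fix t
  \<comment> \<open>\<open>e * exp\<close> has slope \<open>2 * f\<close> at \<open>c\<close>. For
    negative \<open>t\<close> the tangent there bounds the exponential term below by
    \<open>2 * f * \<bar>t\<bar>\<close> up to a constant: one half absorbs \<open>f * t\<close>,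
    the other remains.\<close>
  define c where "c = ln (2 * f / e)"
  have e: "e * exp c = 2 * f"
    using assms by (simp add: c_def)
  show "f * \<bar>t\<bar> - 2 * f * \<bar>ln (2 * f / e)\<bar> \<le> f * t + e * exp (- t)"
  proof (cases "t \<ge> 0")
    case True
    have "0 \<le> 2 * f * \<bar>ln (2 * f / e)\<bar>" "0 \<le> e * exp (- t)"
      using assms by simp_all
    moreover have "f * \<bar>t\<bar> = f * t"
      using True by simp
    ultimately show ?thesis by linarith
  next
    case False
    have "2 * f * (1 + (- t - c)) \<le> 2 * f * exp (- t - c)"
      using assms exp_ge_add_one_self[of "- t - c"] by (intro mult_left_mono) auto
    also have "\<dots> = e * exp (- t)"
      by (simp add: e[symmetric] mult_exp_exp)
    finally have "2 * f - 2 * f * t - 2 * f * c \<le> e * exp (- t)"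
      by (simp add: algebra_simps)
    moreover have "f * c \<le> f * \<bar>c\<bar>"
      using assms by (intro mult_left_mono) auto
    moreover have "f * \<bar>t\<bar> = - (f * t)"
      using False by simp
    ultimately show ?thesis
      unfolding c_def[symmetric] using assms by linarith
  qed
qed

section \<open>The entropy closure\<close>

text \<open>\<open>moment_type\<close> fixes the index type of the moments, which occurs in the type
  of no other parameter.\<close>

locale entropy_closure =
  fixes v dv w :: "(real, 'n::{finite,linorder}) vec" and lam :: real
    and moment_type :: "'m::{finite,linorder} itself"
  assumes card_less: "CARD('m) < CARD('n)"
    and strict_mono_v: "strict_mono (($) v)"
    and dv_pos: "dv $ l > 0"
    and w_pos: "w $ l > 0"
begin

lemma inj_v: "inj (($) v)"
  by (rule strict_mono_imp_inj_on[OF strict_mono_v])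

abbreviation p :: "'n \<Rightarrow> (real, 'm) vec" where
  "p l \<equiv> pvec (v $ l)"

abbreviation h :: "'n \<Rightarrow> real \<Rightarrow> real" where
  "h \<equiv> entropy_density dv w lam"

text \<open>Exponential family: \<open>dens y l\<close> is the point where \<open>h l\<close> has
  slope \<open>- (y \<bullet> p l)\<close>.\<close>

definition dens :: "(real, 'm) vec \<Rightarrow> 'n \<Rightarrow> real" where
  "dens y l = exp (- 1 - lam * kappa dv w l - y \<bullet> p l)"

definition moments :: "('n \<Rightarrow> real) \<Rightarrow> (real, 'm) vec" where
  "moments f = (\<Sum>l\<in>UNIV. (dv $ l * f l) *\<^sub>R p l)"

lemma dens_pos: "dens y l > 0"
  by (simp add: dens_def)

lemma ln_dens: "ln (dens y l) = - 1 - lam * kappa dv w l - y \<bullet> p l"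
  by (simp add: dens_def)

lemma moment_matrix_mult: "moment_matrix v dv *v (f :: (real, 'n) vec) = moments (($) f)"
  by (simp add: moment_matrix_def moments_def matrix_vector_mult_def vec_eq_iff mult_ac)

lemma inner_moments: "y \<bullet> moments f = (\<Sum>l\<in>UNIV. dv $ l * f l * (y \<bullet> p l))"
  by (simp add: moments_def inner_sum_right)

section \<open>Primal and dual optimality of the exponential densities\<close>

text \<open>Pythagorean inequality for the relative entropy; it yields optimality of the exponential
  density in the primal problem and strict convexity of the entropy alike.\<close>

lemma entropy_gap:
  assumes f: "\<And>l. f l \<ge> 0" and "f \<noteq> dens y"
  shows "(\<Sum>l\<in>UNIV. dv $ l * h l (dens y l)) - y \<bullet> (moments f - moments (dens y)) <
    (\<Sum>l\<in>UNIV. dv $ l * h l (f l))"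
proof -
  \<comment> \<open>\<open>?t l\<close> is the value at \<open>f l\<close> of the tangent to
    \<open>h l\<close> at \<open>dens y l\<close>.\<close>
  let ?t = "\<lambda>l. h l (dens y l) - (y \<bullet> p l) * (f l - dens y l)"
  have strict: "?t l < h l (f l)" if "f l \<noteq> dens y l" for l
    using xlnx_above_tangent[OF dens_pos f that]
    by (simp add: entropy_density_def ln_dens algebra_simps)
  then have le: "?t l \<le> h l (f l)" for l
    by (cases "f l = dens y l") (auto simp: less_imp_le)
  obtain l where "f l \<noteq> dens y l"
    using assms(2) by blast
  then have "(\<Sum>l\<in>UNIV. dv $ l * ?t l) < (\<Sum>l\<in>UNIV. dv $ l * h l (f l))"
    using strict dv_pos le by (intro sum_strict_mono_ex1) (auto simp: less_imp_le)
  moreover have "(\<Sum>l\<in>UNIV. dv $ l * ?t l) =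
      (\<Sum>l\<in>UNIV. dv $ l * h l (dens y l)) - y \<bullet> (moments f - moments (dens y))"
    by (simp add: inner_diff_right inner_moments sum_subtractf sum.distrib algebra_simps)
  ultimately show ?thesis by simp
qed

text \<open>\<open>kappa\<close> is scaled so that the penalty on nonnegative \<open>g\<close>
  becomes a linear term in \<open>w * g\<close>.\<close>

lemma primal_objective_eq:
  assumes "\<And>l. g $ l \<ge> 0"
  shows "primal_objective dv w lam g = (\<Sum>l\<in>UNIV. dv $ l * h l (w $ l * g $ l))"
proof -
  have "dv $ l * (lam * kappa dv w l * (w $ l * g $ l)) = lam * \<bar>g $ l\<bar>" for l
    using assms[of l] dv_pos[of l] w_pos[of l] by (simp add: kappa_def)
  then have "dv $ l * h l (w $ l * g $ l) = dv $ l * (w $ l * g $ l * ln (w $ l * g $ l)) + lam * \<bar>g $ l\<bar>" for l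
    by (simp add: entropy_density_def distrib_left)
  then show ?thesis
    by (simp add: primal_objective_def sum.distrib sum_distrib_left)
qed

lemma primal_feasible_iff:
  "primal_feasible v dv w m g \<longleftrightarrow> (\<forall>l. g $ l \<ge> 0) \<and> moments (\<lambda>l. w $ l * g $ l) = m"
  by (simp add: primal_feasible_def moment_matrix_mult moments_def)

text \<open>Feasible competitors share the moments of \<open>dens y\<close>, so the linear term of
  \<open>entropy_gap\<close> vanishes and strict minimality remains.\<close>

lemma f_star_moments_dens: "f_star v dv w lam (moments (dens y)) = (\<chi> l. dens y l)"
proof -
  let ?m = "moments (dens y)" and ?g = "\<chi> l. dens y l / w $ l"
  have w: "w $ l * (?g $ l) = dens y l" for l
    using w_pos[of l] by simp
  have nonneg: "?g $ l \<ge> 0" for l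
    using w_pos[of l] dens_pos[of y l] by simp
  have feas: "primal_feasible v dv w ?m ?g"
    unfolding primal_feasible_iff w using nonneg by simp
  have opt: "primal_objective dv w lam ?g < primal_objective dv w lam g"
    if g: "primal_feasible v dv w ?m g" and ne: "g \<noteq> ?g" for g
  proof -
    have g_nonneg: "g $ l \<ge> 0" for l
      using g by (simp add: primal_feasible_iff)
    have "(\<lambda>l. w $ l * g $ l) \<noteq> dens y"
    proof
      assume "(\<lambda>l. w $ l * g $ l) = dens y"
      then have "w $ l * g $ l = dens y l" for l
        by (rule fun_cong)
      then have "g $ l = dens y l / w $ l" for l
        using w_pos[of l] by (metis less_irrefl nonzero_mult_div_cancel_left)
      then show False
        using ne by (simp add: vec_eq_iff)
    qed
    moreover have "0 \<le> w $ l * g $ l" for l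
      using g_nonneg[of l] w_pos[of l] by simp
    ultimately have "(\<Sum>l\<in>UNIV. dv $ l * h l (dens y l)) < (\<Sum>l\<in>UNIV. dv $ l * h l (w $ l * g $ l))"
      using entropy_gap[of "\<lambda>l. w $ l * g $ l" y] g by (simp add: primal_feasible_iff)
    then show ?thesis
      unfolding primal_objective_eq[of g, OF g_nonneg] primal_objective_eq[of ?g, OF nonneg] w .
  qed
  have "g_star v dv w lam ?m = ?g"
    unfolding g_star_def using feas opt by (rule the_is_arg_min)
  then show ?thesis
    using w by (simp add: f_star_def vec_eq_iff)
qed

lemma dual_function_eq:
  "dual_function v dv w lam m y = y \<bullet> m + (\<Sum>l\<in>UNIV. dv $ l * dens y l)"
  by (simp add: dual_function_def dens_def)

text \<open>The tangent inequalities of \<open>exp\<close> at the nodes sum to strict minimality;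
  one of them is strict because a nonzero \<open>z - y\<close> is not orthogonal to every
  \<open>p l\<close>.\<close>

lemma y_star_moments_dens: "y_star v dv w lam (moments (dens y)) = y"
proof -
  let ?\<Psi> = "dual_function v dv w lam (moments (dens y))"
  have opt: "?\<Psi> y < ?\<Psi> z" if "z \<noteq> y" for z
  proof -
    have dens_z: "dens z l = dens y l * exp (- ((z - y) \<bullet> p l))" for l
      by (simp add: dens_def mult_exp_exp inner_diff_left algebra_simps)
    have strict: "dens y l * (1 - (z - y) \<bullet> p l) < dens z l" if "(z - y) \<bullet> p l \<noteq> 0" for l
      unfolding dens_z using exp_gt_tangent[of "- ((z - y) \<bullet> p l)"] that dens_pos[of y l] by simp
    then have le: "dens y l * (1 - (z - y) \<bullet> p l) \<le> dens z l" for l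
      by (cases "(z - y) \<bullet> p l = 0") (auto simp: less_imp_le dens_z)
    have "\<exists>l. (z - y) \<bullet> p l \<noteq> 0"
    proof (rule ccontr)
      assume "\<not> ?thesis"
      then have "(z - y) \<bullet> p l = 0" for l
        by blast
      then have "z - y = 0"
        by (rule pvec_total[OF inj_v card_less])
      then show False
        using \<open>z \<noteq> y\<close> by simp
    qed
    then obtain l where "(z - y) \<bullet> p l \<noteq> 0" ..
    then have "(\<Sum>l\<in>UNIV. dv $ l * (dens y l * (1 - (z - y) \<bullet> p l))) < (\<Sum>l\<in>UNIV. dv $ l * dens z l)"
      using strict dv_pos le by (intro sum_strict_mono_ex1) (auto simp: less_imp_le)
    moreover have "(\<Sum>l\<in>UNIV. dv $ l * (dens y l * (1 - (z - y) \<bullet> p l))) =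
        (\<Sum>l\<in>UNIV. dv $ l * dens y l) - (z - y) \<bullet> moments (dens y)"
      by (simp add: inner_moments sum_subtractf sum.distrib algebra_simps)
    ultimately show ?thesis
      by (simp add: dual_function_eq inner_diff_left)
  qed
  show ?thesis
    unfolding y_star_def using TrueI opt by (rule the_is_arg_min)
qed

section \<open>The moment map: derivative, range and inverse\<close>

lemma has_derivative_dens:
  "((\<lambda>y. dens y l) has_derivative (\<lambda>x. - (dens y l * (x \<bullet> p l)))) (at y)"
  unfolding dens_def by (auto intro!: derivative_eq_intros)

lemma has_derivative_moments_dens:
  "((\<lambda>y. moments (dens y)) has_derivative (\<lambda>x. - (gram v (\<lambda>l. dv $ l * dens y l) *v x))) (at y)"
  unfolding moments_def gram_mult
  by (auto intro!: derivative_eq_intros has_derivative_dens simp: sum_negf mult_ac)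

lemma continuous_on_dual_function: "continuous_on S (dual_function v dv w lam m)"
  for S :: "(real, 'm) vec set"
  unfolding dual_function_def by (intro continuous_intros)

text \<open>For the hard inclusion, a positive \<open>f\<close> with moments \<open>m\<close>
  rewrites \<open>y \<bullet> m\<close> as a positively weighted sum of the
  \<open>y \<bullet> p l\<close>. Each term together with its exponential grows linearly in
  \<open>\<bar>y \<bullet> p l\<bar>\<close>, so the dual function is coercive. At its minimizer the
  gradient \<open>m - moments (dens y)\<close> vanishes.\<close>

lemma realizable_eq_range: "realizable v dv = range (\<lambda>y. moments (dens y))"
proof (intro equalityI subsetI)
  fix m :: "(real, 'm) vec" assume "m \<in> range (\<lambda>y. moments (dens y))"
  then obtain y where "m = moments (dens y)" by blast
  then have "m = moment_matrix v dv *v (\<chi> l. dens y l)"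
    by (simp add: moment_matrix_mult moments_def)
  then show "m \<in> realizable v dv"
    unfolding realizable_def using dens_pos by fastforce
next
  fix m :: "(real, 'm) vec" assume "m \<in> realizable v dv"
  then obtain f where m: "m = moments (($) f)" and f: "\<And>l. f $ l > 0"
    by (auto simp: realizable_def moment_matrix_mult)
  let ?\<Psi> = "dual_function v dv w lam m"
  define e where "e l = exp (- 1 - lam * kappa dv w l)" for l
  have dens_e: "dens y l = e l * exp (- (y \<bullet> p l))" for y l
    by (simp add: dens_def e_def mult_exp_exp)
  have "\<forall>l. \<exists>B. \<forall>t. f $ l * \<bar>t\<bar> - B \<le> f $ l * t + e l * exp (- t)"
    using linear_plus_exp_coercive f by (simp add: e_def)
  then obtain B where B: "\<And>l t. f $ l * \<bar>t\<bar> - B l \<le> f $ l * t + e l * exp (- t)"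
    by metis
  \<comment> \<open>The l1 norm of \<open>L y\<close> is the growing part of the lower bound;
    injectivity makes it dominate a multiple of \<open>norm y\<close>.\<close>
  define L :: "(real, 'm) vec \<Rightarrow> (real, 'n) vec" where "L y = (\<chi> l. dv $ l * f $ l * (y \<bullet> p l))" for y
  have "linear L"
    by (rule linearI) (simp_all add: L_def vec_eq_iff inner_add_left algebra_simps)
  moreover have "inj L"
    unfolding linear_injective_0[OF \<open>linear L\<close>]
  proof (intro allI impI)
    fix y assume "L y = 0"
    then have "dv $ l * f $ l * (y \<bullet> p l) = 0" for l
      by (simp add: L_def vec_eq_iff)
    then have "y \<bullet> p l = 0" for l
      using f[of l] dv_pos[of l] by (metis less_irrefl mult_eq_0_iff)
    then show "y = 0"
      by (rule pvec_total[OF inj_v card_less])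
  qed
  ultimately obtain C where C: "C > 0" "\<And>y. C * norm y \<le> norm (L y)"
    by (metis linear_inj_bounded_below_pos mult.commute)
  have lower: "C * norm y - (\<Sum>l\<in>UNIV. dv $ l * B l) \<le> ?\<Psi> y" for y
  proof -
    have "C * norm y \<le> (\<Sum>l\<in>UNIV. \<bar>L y $ l\<bar>)"
      using C(2)[of y] norm_le_l1_cart[of "L y"] by linarith
    also have "\<dots> = (\<Sum>l\<in>UNIV. dv $ l * (f $ l * \<bar>y \<bullet> p l\<bar>))"
      using f dv_pos by (simp add: L_def abs_mult less_imp_le mult_ac)
    finally have "C * norm y - (\<Sum>l\<in>UNIV. dv $ l * B l) \<le> (\<Sum>l\<in>UNIV. dv $ l * (f $ l * \<bar>y \<bullet> p l\<bar> - B l))"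
      by (simp add: right_diff_distrib sum_subtractf)
    also have "\<dots> \<le> (\<Sum>l\<in>UNIV. dv $ l * (f $ l * (y \<bullet> p l) + e l * exp (- (y \<bullet> p l))))"
      using B dv_pos by (intro sum_mono mult_left_mono) (auto simp: less_imp_le)
    also have "\<dots> = ?\<Psi> y"
      by (simp add: dual_function_eq dens_e m inner_moments sum.distrib[symmetric] algebra_simps)
    finally show ?thesis .
  qed
  \<comment> \<open>This sublevel set is compact by coercivity, and outside it the dual function
    exceeds its value at 0.\<close>
  define S where "S = {y. ?\<Psi> y \<le> ?\<Psi> 0}"
  have "closed S"
    unfolding S_def using continuous_on_dual_function[of UNIV m]
    by (intro closed_Collect_le) auto
  moreover have "bounded S"
  proof (rule boundedI)
    fix y assume "y \<in> S"
    then have "C * norm y \<le> ?\<Psi> 0 + (\<Sum>l\<in>UNIV. dv $ l * B l)"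
      using lower[of y] by (simp add: S_def)
    then show "norm y \<le> (?\<Psi> 0 + (\<Sum>l\<in>UNIV. dv $ l * B l)) / C"
      using C(1) by (simp add: pos_le_divide_eq mult.commute)
  qed
  ultimately have "compact S"
    by (simp add: compact_eq_bounded_closed)
  moreover have "0 \<in> S"
    by (simp add: S_def)
  ultimately obtain y where y: "y \<in> S" "\<And>z. z \<in> S \<Longrightarrow> ?\<Psi> y \<le> ?\<Psi> z"
    using continuous_attains_inf[of S ?\<Psi>, OF _ _ continuous_on_dual_function] by blast
  have min: "?\<Psi> y \<le> ?\<Psi> z" for z
  proof (cases "z \<in> S")
    case False
    then show ?thesis
      using y(2)[OF \<open>0 \<in> S\<close>] by (simp add: S_def)
  qed (rule y(2))
  have "(?\<Psi> has_derivative (\<lambda>x. x \<bullet> (m - moments (dens y)))) (at y)"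
    unfolding dual_function_eq[abs_def]
    by (auto intro!: derivative_eq_intros has_derivative_dens
        simp: inner_diff_right inner_moments sum_negf mult_ac)
  then have "(\<lambda>x. x \<bullet> (m - moments (dens y))) = (\<lambda>x. 0)"
    by (rule differential_zero_maxmin[of y UNIV, rotated 2]) (use min in auto)
  \<comment> \<open>The vanishing derivative is evaluated in the direction of the gradient
    itself.\<close>
  then have "(m - moments (dens y)) \<bullet> (m - moments (dens y)) = 0"
    by (rule fun_cong)
  then show "m \<in> range (\<lambda>y. moments (dens y))"
    by simp
qed

text \<open>The left inverse \<open>y_star\<close> makes the moment map injective, so invariance of
  domain applies. Openness later lets derivatives be computed from formulas valid only on the
  realizable set.\<close>

lemma open_realizable: "open (realizable v dv :: (real, 'm) vec set)"
  unfolding realizable_eq_range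
proof (rule invariance_of_domain)
  show "continuous_on UNIV (\<lambda>y. moments (dens y))"
    unfolding moments_def dens_def by (intro continuous_intros)
  show "inj (\<lambda>y. moments (dens y))"
    using y_star_moments_dens by (rule inj_on_inverseI)
qed simp

lemma convex_realizable: "convex (realizable v dv :: (real, 'm) vec set)"
proof -
  have "convex {f :: (real, 'n) vec. \<forall>l. f $ l > 0}"
    unfolding convex_def
  proof (safe, goal_cases)
    case (1 x y a b l)
    then have "a > 0 \<or> b > 0" by linarith
    then show ?case
      using 1 by (auto intro: add_pos_nonneg add_nonneg_pos simp: less_imp_le)
  qed
  then have "convex ((*v) (moment_matrix v dv :: ((real, 'n) vec, 'm) vec) ` {f. \<forall>l. f $ l > 0})"
    by (rule convex_linear_image[OF matrix_vector_mul_linear])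
  moreover have "realizable v dv = (*v) (moment_matrix v dv :: ((real, 'n) vec, 'm) vec) ` {f. \<forall>l. f $ l > 0}"
    by (auto simp: realizable_def)
  ultimately show ?thesis by simp
qed

section \<open>Closure quantities expressed through the dual variable\<close>

lemma f_star_realizable:
  "m \<in> realizable v dv \<Longrightarrow> f_star v dv w lam m $ l = dens (y_star v dv w lam m) l"
  by (auto simp: realizable_eq_range f_star_moments_dens y_star_moments_dens)

lemma moments_dens_y_star:
  "m \<in> realizable v dv \<Longrightarrow> moments (dens (y_star v dv w lam m)) = m"
  by (auto simp: realizable_eq_range y_star_moments_dens)

lemma gram_H_eq:
  fixes m :: "(real, 'm) vec"
  assumes "m \<in> realizable v dv"
  shows "gram_H v dv w lam m = gram v (\<lambda>l. dv $ l * dens (y_star v dv w lam m) l)"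
  by (simp add: gram_H_def gram_def f_star_realizable[OF assms])

lemma gram_K_eq:
  fixes m :: "(real, 'm) vec"
  assumes "m \<in> realizable v dv"
  shows "gram_K v dv w lam m = gram v (\<lambda>l. v $ l * (dv $ l * dens (y_star v dv w lam m) l))"
  by (simp add: gram_K_def gram_def f_star_realizable[OF assms] mult_ac)

lemma sym_pos_def_gram_H:
  fixes m :: "(real, 'm) vec"
  assumes "m \<in> realizable v dv"
  shows "sym_pos_def (gram_H v dv w lam m)"
  unfolding gram_H_eq[OF assms]
  by (rule sym_pos_def_gram[OF inj_v card_less]) (simp add: dv_pos dens_pos)

text \<open>Inverse function theorem with the known left inverse \<open>y_star\<close>: the
  derivative \<open>-H\<close> of the moment map is inverted by \<open>-H^-1\<close>.\<close>

lemma has_derivative_y_star: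
  fixes m :: "(real, 'm) vec"
  assumes m: "m \<in> realizable v dv"
  shows "(y_star v dv w lam has_derivative (\<lambda>x. - (matrix_inv (gram_H v dv w lam m) *v x))) (at m)"
proof -
  let ?y = "y_star v dv w lam m" and ?H = "gram_H v dv w lam m"
  have "(y_star v dv w lam has_derivative (\<lambda>x. - (matrix_inv ?H *v x))) (at (moments (dens ?y)))"
  proof (rule has_derivative_inverse_strong[of UNIV ?y "\<lambda>y. moments (dens y)"])
    show "continuous_on UNIV (\<lambda>y. moments (dens y))"
      unfolding moments_def dens_def by (intro continuous_intros)
    show "((\<lambda>y. moments (dens y)) has_derivative (\<lambda>x. - (?H *v x))) (at ?y)"
      unfolding gram_H_eq[OF m] by (rule has_derivative_moments_dens)
    show "(\<lambda>x. - (?H *v x)) \<circ> (\<lambda>x. - (matrix_inv ?H *v x)) = id"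
      using matrix_inv_cancel[OF sym_pos_def_invertible[OF sym_pos_def_gram_H[OF m]]]
      by (auto simp: fun_eq_iff matrix_vector_mul_assoc vec.neg)
  qed (simp_all add: y_star_moments_dens)
  then show ?thesis
    by (simp add: moments_dens_y_star[OF m])
qed

lemma has_derivative_dens_y_star:
  fixes m :: "(real, 'm) vec"
  assumes m: "m \<in> realizable v dv"
  shows "((\<lambda>m. dens (y_star v dv w lam m) l) has_derivative
    (\<lambda>x. dens (y_star v dv w lam m) l * ((matrix_inv (gram_H v dv w lam m) *v x) \<bullet> p l))) (at m)"
  using has_derivative_compose[OF has_derivative_y_star[OF m] has_derivative_dens] by simp

text \<open>General in \<open>c\<close> so that \<open>dv\<close> yields the entropy and
  \<open>dv * v\<close> the entropy flux. The slope of \<open>h l\<close> at the closure density is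
  linear in \<open>p l\<close>, so the chain rule produces a Gram matrix.\<close>

lemma has_derivative_weighted_entropy:
  fixes m :: "(real, 'm) vec"
  assumes m: "m \<in> realizable v dv"
  shows "((\<lambda>m. \<Sum>l\<in>UNIV. c l * h l (f_star v dv w lam m $ l)) has_derivative
    (\<lambda>x. - (y_star v dv w lam m \<bullet>
       (gram v (\<lambda>l. c l * dens (y_star v dv w lam m) l) *v (matrix_inv (gram_H v dv w lam m) *v x))))) (at m)"
    (is "(?f has_derivative ?f') (at m)")
proof -
  let ?y = "y_star v dv w lam" and ?d = "\<lambda>m l. dens (y_star v dv w lam m) l"
  have "(h l has_field_derivative (- (?y m \<bullet> p l))) (at (?d m l))" for l
    unfolding entropy_density_def[abs_def]
    by (rule derivative_eq_intros refl | use dens_pos[of "?y m" l] in \<open>simp add: ln_dens\<close>)+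
  then have "((\<lambda>m. h l (?d m l)) has_derivative
     (\<lambda>x. (?d m l * ((matrix_inv (gram_H v dv w lam m) *v x) \<bullet> p l)) * - (?y m \<bullet> p l))) (at m)" for l
    by (rule DERIV_compose_FDERIV[OF _ has_derivative_dens_y_star[OF m]])
  then have "((\<lambda>m. \<Sum>l\<in>UNIV. c l * h l (?d m l)) has_derivative
     (\<lambda>x. \<Sum>l\<in>UNIV. c l * ((?d m l * ((matrix_inv (gram_H v dv w lam m) *v x) \<bullet> p l)) * - (?y m \<bullet> p l)))) (at m)"
    by (intro has_derivative_sum has_derivative_mult_right)
  moreover have "(\<lambda>x. \<Sum>l\<in>UNIV. c l * ((?d m l * ((matrix_inv (gram_H v dv w lam m) *v x) \<bullet> p l)) * - (?y m \<bullet> p l))) = ?f'"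
    by (simp add: fun_eq_iff gram_mult inner_sum_right sum_negf mult_ac)
  ultimately have "((\<lambda>m. \<Sum>l\<in>UNIV. c l * h l (?d m l)) has_derivative ?f') (at m)"
    by simp
  then show ?thesis
    by (rule has_derivative_transform_within_open[OF _ open_realizable m]) (simp add: f_star_realizable)
qed

text \<open>Puts the shifted moments and the predicted moment into one form: in either case the
  velocity raises the exponent by one.\<close>

lemma flux_eq:
  fixes m :: "(real, 'm) vec"
  assumes m: "m \<in> realizable v dv"
  shows "flux v dv w lam m = (\<Sum>l\<in>UNIV. (v $ l * dv $ l * dens (y_star v dv w lam m) l) *\<^sub>R p l)"
proof -
  let ?d = "dens (y_star v dv w lam m)"
  have "flux v dv w lam m $ k = (\<Sum>l\<in>UNIV. v $ l * dv $ l * ?d l * v $ l ^ index_degree k)" for k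
  proof (cases "\<exists>j. k < j")
    case True
    then have "flux v dv w lam m $ k = moments ?d $ (LEAST j. k < j)"
      by (simp add: flux_def moments_dens_y_star[OF m])
    also have "\<dots> = (\<Sum>l\<in>UNIV. v $ l * dv $ l * ?d l * v $ l ^ index_degree k)"
      by (simp add: moments_def pvec_def index_degree_next[OF True] mult_ac)
    finally show ?thesis .
  next
    case False
    have "flux v dv w lam m $ k = next_row v dv CARD('m) \<bullet> f_star v dv w lam m"
      by (simp only: flux_def vec_lambda_beta if_not_P[OF False])
    also have "\<dots> = (\<Sum>l\<in>UNIV. v $ l * dv $ l * ?d l * v $ l ^ index_degree k)"
      by (simp add: next_row_def inner_vec_def f_star_realizable[OF m] index_degree_last[OF False] mult_ac)
    finally show ?thesis .
  qed
  then show ?thesis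
    by (simp add: vec_eq_iff pvec_def)
qed

text \<open>Only the densities vary with \<open>m\<close>; summing their derivatives against
  \<open>v * p\<close> gives \<open>K\<close> applied to \<open>H^-1 x\<close>.\<close>

lemma has_derivative_flux:
  fixes m :: "(real, 'm) vec"
  assumes m: "m \<in> realizable v dv"
  shows "(flux v dv w lam has_derivative
    (\<lambda>x. (gram_K v dv w lam m ** matrix_inv (gram_H v dv w lam m)) *v x)) (at m)"
proof -
  let ?d = "\<lambda>m l. dens (y_star v dv w lam m) l"
  have "((\<lambda>m. \<Sum>l\<in>UNIV. (v $ l * dv $ l * ?d m l) *\<^sub>R p l) has_derivative
     (\<lambda>x. \<Sum>l\<in>UNIV. (v $ l * dv $ l * (?d m l * ((matrix_inv (gram_H v dv w lam m) *v x) \<bullet> p l))) *\<^sub>R p l)) (at m)"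
    by (intro has_derivative_sum has_derivative_scaleR_left has_derivative_mult_right
        has_derivative_dens_y_star[OF m])
  moreover have "(\<lambda>x. \<Sum>l\<in>UNIV. (v $ l * dv $ l * (?d m l * ((matrix_inv (gram_H v dv w lam m) *v x) \<bullet> p l))) *\<^sub>R p l) =
     (\<lambda>x. (gram_K v dv w lam m ** matrix_inv (gram_H v dv w lam m)) *v x)"
    unfolding gram_K_eq[OF m] matrix_vector_mul_assoc[symmetric] gram_mult
    by (simp add: fun_eq_iff mult_ac)
  ultimately have "((\<lambda>m. \<Sum>l\<in>UNIV. (v $ l * dv $ l * ?d m l) *\<^sub>R p l) has_derivative
     (\<lambda>x. (gram_K v dv w lam m ** matrix_inv (gram_H v dv w lam m)) *v x)) (at m)"
    by simp
  then show ?thesis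
    by (rule has_derivative_transform_within_open[OF _ open_realizable m]) (simp add: flux_eq)
qed

text \<open>\<open>entropy_gap\<close> between two closure densities is the supporting inequality
  with slope \<open>- y_star\<close>.\<close>

lemma strictly_convex_closure_entropy:
  "strictly_convex_on (realizable v dv :: (real, 'm) vec set) (closure_entropy v dv w lam)"
proof (rule strictly_convex_onI_gradient[OF convex_realizable])
  fix m m' :: "(real, 'm) vec"
  assume m: "m \<in> realizable v dv" and m': "m' \<in> realizable v dv" and "m \<noteq> m'"
  let ?y = "y_star v dv w lam"
  have "dens (?y m') \<noteq> dens (?y m)"
    using \<open>m \<noteq> m'\<close> moments_dens_y_star[OF m] moments_dens_y_star[OF m'] by metis
  from entropy_gap[OF _ this] show
    "closure_entropy v dv w lam m + (- ?y m) \<bullet> (m' - m) < closure_entropy v dv w lam m'"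
    by (simp add: closure_entropy_def f_star_realizable m m' moments_dens_y_star dens_pos less_imp_le)
qed

text \<open>With weights \<open>dv\<close> the Gram matrix is \<open>H\<close> itself and cancels
  its inverse.\<close>

lemma GDERIV_closure_entropy:
  fixes m :: "(real, 'm) vec"
  assumes m: "m \<in> realizable v dv"
  shows "GDERIV (closure_entropy v dv w lam) m :> - y_star v dv w lam m"
proof -
  have "gram_H v dv w lam m *v (matrix_inv (gram_H v dv w lam m) *v x) = x" for x
    using matrix_inv_cancel[OF sym_pos_def_invertible[OF sym_pos_def_gram_H[OF m]]]
    by (simp add: matrix_vector_mul_assoc)
  then show ?thesis
    using has_derivative_weighted_entropy[OF m, of "($) dv"]
    unfolding gderiv_def closure_entropy_def[abs_def] gram_H_eq[OF m, symmetric]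
    by (simp add: inner_commute)
qed

text \<open>With weights \<open>dv * v\<close> the Gram matrix is \<open>K\<close>, and
  \<open>K H^-1\<close> is the flux Jacobian; its transpose moves onto the gradient.\<close>

lemma GDERIV_closure_entropy_flux:
  fixes m :: "(real, 'm) vec"
  assumes m: "m \<in> realizable v dv"
  shows "GDERIV (closure_entropy_flux v dv w lam) m :>
    transpose (jacobian (flux v dv w lam) (at m)) *v (- y_star v dv w lam m)"
proof -
  have "gram v (\<lambda>l. dv $ l * v $ l * dens (y_star v dv w lam m) l) = gram_K v dv w lam m"
    unfolding gram_K_eq[OF m] by (simp add: mult_ac)
  then show ?thesis
    using has_derivative_weighted_entropy[OF m, of "\<lambda>l. dv $ l * v $ l"]
    unfolding gderiv_def closure_entropy_flux_def[abs_def] inner_transpose_mult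
      jacobian_eqI[OF has_derivative_flux[OF m]]
    by (simp add: inner_commute matrix_vector_mul_assoc)
qed

lemma has_hessian_closure_entropy:
  fixes m :: "(real, 'm) vec"
  assumes m: "m \<in> realizable v dv"
  shows "has_hessian (closure_entropy v dv w lam) (matrix_inv (gram_H v dv w lam m)) m"
  unfolding has_hessian_def
proof (intro exI conjI)
  \<comment> \<open>The gradient formula must hold near \<open>m\<close>, not only at
    \<open>m\<close>; openness provides this.\<close>
  show "\<forall>\<^sub>F y in nhds m. GDERIV (closure_entropy v dv w lam) y :> - y_star v dv w lam y"
    using eventually_nhds_in_open[OF open_realizable m]
    by eventually_elim (rule GDERIV_closure_entropy)
  show "((\<lambda>y. - y_star v dv w lam y) has_derivative (\<lambda>h. matrix_inv (gram_H v dv w lam m) *v h)) (at m)"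
    using has_derivative_minus[OF has_derivative_y_star[OF m]] by simp
qed

text \<open>\<open>H^-1 F' = H^-1 K H^-1\<close> is a congruence transform of the symmetric
  \<open>K\<close>.\<close>

lemma symmetric_hyperbolic_flux:
  fixes m :: "(real, 'm) vec"
  assumes m: "m \<in> realizable v dv"
  shows "symmetric_hyperbolic_at (flux v dv w lam) (matrix_inv (gram_H v dv w lam m)) m"
proof -
  let ?Hi = "matrix_inv (gram_H v dv w lam m)" and ?K = "gram_K v dv w lam m"
  have Hi: "sym_pos_def ?Hi"
    by (rule sym_pos_def_matrix_inv[OF sym_pos_def_gram_H[OF m]])
  have "transpose ?K = ?K"
    using sym_matrix_gram unfolding gram_K_eq[OF m] sym_matrix_def .
  moreover have "transpose ?Hi = ?Hi"
    using Hi by (simp add: sym_pos_def_def sym_matrix_def)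
  ultimately have "sym_matrix (?Hi ** (?K ** ?Hi))"
    by (simp add: sym_matrix_def matrix_transpose_mul matrix_mul_assoc)
  then show ?thesis
    using Hi has_derivative_flux[OF m] jacobian_eqI[OF has_derivative_flux[OF m]]
    by (auto simp: symmetric_hyperbolic_at_def differentiable_def)
qed

lemma mu_star_eq:
  fixes m :: "(real, 'm) vec"
  assumes "m \<in> realizable v dv"
  shows "mu_star v dv w lam m = distr (density (count_space UNIV)
    (\<lambda>l. ennreal (dv $ l * dens (y_star v dv w lam m) l))) borel (($) v)"
  by (simp add: mu_star_def f_star_realizable[OF assms])

end

theorem theorem3:
  fixes v dv w :: "real^'n::{finite,linorder}" and lam :: real
  assumes "CARD('m::{finite,linorder}) < CARD('n)"
    and "strict_mono (\<lambda>l. v $ l)"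
    and "\<And>l. dv $ l > 0"
    and "lam \<ge> 0"
    and "\<And>l. w $ l > 0"
    and "rank (moment_matrix v dv :: real^'n::{finite,linorder}^'m::{finite,linorder}) = CARD('m)"
  defines "R \<equiv> realizable v dv :: (real^'m::{finite,linorder}) set"
    and "F \<equiv> flux v dv w lam :: real^'m::{finite,linorder} \<Rightarrow> _"
    and "H \<equiv> gram_H v dv w lam :: real^'m::{finite,linorder} \<Rightarrow> _"
    and "K \<equiv> gram_K v dv w lam :: real^'m::{finite,linorder} \<Rightarrow> _"
    and "\<eta> \<equiv> closure_entropy v dv w lam :: real^'m::{finite,linorder} \<Rightarrow> real"
    and "\<psi> \<equiv> closure_entropy_flux v dv w lam :: real^'m::{finite,linorder} \<Rightarrow> real"
  shows
    "strictly_convex_on R \<eta> \<and>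
     (\<forall>m\<in>R.
        GDERIV \<eta> m :> - y_star v dv w lam m \<and>
        invertible (H m) \<and>
        has_hessian \<eta> (matrix_inv (H m)) m \<and>
        sym_pos_def (matrix_inv (H m)) \<and>
        entropy_pair_at F \<eta> \<psi> m \<and>
        F differentiable (at m) \<and>
        jacobian F (at m) = K m ** matrix_inv (H m) \<and>
        symmetric_hyperbolic_at F (matrix_inv (H m)) m) \<and>
     (\<forall>m\<in>R.
        strictly_hyperbolic_at F m \<and>
        (\<exists>\<theta> :: 'm::{finite,linorder} \<Rightarrow> real.
           strict_mono \<theta> \<and>
           range \<theta> = gauss_nodes (mu_star v dv w lam m) CARD('m) \<and>
           eigenvals (jacobian F (at m)) = complex_of_real ` range \<theta> \<and>
           (\<forall>k. v $ Min UNIV < \<theta> k \<and> \<theta> k < v $ Max UNIV)))"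
proof -
  interpret entropy_closure v dv w lam "TYPE('m)"
    using assms(1,2,3,5) by unfold_locales auto
  show ?thesis
    unfolding R_def F_def H_def K_def \<eta>_def \<psi>_def
  proof (intro conjI ballI)
    show "strictly_convex_on (realizable v dv :: (real, 'm) vec set) (closure_entropy v dv w lam)"
      by (rule strictly_convex_closure_entropy)
  next
    fix m :: "(real, 'm) vec" assume m: "m \<in> realizable v dv"
    have diff: "flux v dv w lam differentiable (at m)"
      using has_derivative_flux[OF m] by (rule differentiableI)
    have jac: "jacobian (flux v dv w lam) (at m) = gram_K v dv w lam m ** matrix_inv (gram_H v dv w lam m)"
      by (rule jacobian_eqI[OF has_derivative_flux[OF m]])
    show "GDERIV (closure_entropy v dv w lam) m :> - y_star v dv w lam m"
      by (rule GDERIV_closure_entropy[OF m])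
    show "invertible (gram_H v dv w lam m)"
      by (rule sym_pos_def_invertible[OF sym_pos_def_gram_H[OF m]])
    show "has_hessian (closure_entropy v dv w lam) (matrix_inv (gram_H v dv w lam m)) m"
      by (rule has_hessian_closure_entropy[OF m])
    show "sym_pos_def (matrix_inv (gram_H v dv w lam m))"
      by (rule sym_pos_def_matrix_inv[OF sym_pos_def_gram_H[OF m]])
    show "entropy_pair_at (flux v dv w lam) (closure_entropy v dv w lam) (closure_entropy_flux v dv w lam) m"
      unfolding entropy_pair_at_def
      using diff GDERIV_closure_entropy[OF m] GDERIV_closure_entropy_flux[OF m] by blast
    show "flux v dv w lam differentiable (at m)"
      by (rule diff)
    show "jacobian (flux v dv w lam) (at m) = gram_K v dv w lam m ** matrix_inv (gram_H v dv w lam m)"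
      by (rule jac)
    show "symmetric_hyperbolic_at (flux v dv w lam) (matrix_inv (gram_H v dv w lam m)) m"
      by (rule symmetric_hyperbolic_flux[OF m])
    \<comment> \<open>The common weight of \<open>H\<close>, of \<open>mu_star\<close> and, times
      the velocity, of \<open>K\<close>; it links the Jacobian to the Gauss rule.\<close>
    define c where "c l = dv $ l * dens (y_star v dv w lam m) l" for l
    have pos: "c l > 0" for l
      by (simp add: c_def dv_pos dens_pos)
    have J: "jacobian (flux v dv w lam) (at m) = gram v (\<lambda>l. v $ l * c l) ** matrix_inv (gram v c)"
      unfolding jac gram_K_eq[OF m] gram_H_eq[OF m] c_def ..
    have mu: "mu_star v dv w lam m = distr (density (count_space UNIV) (\<lambda>l. ennreal (c l))) borel (($) v)"
      unfolding mu_star_eq[OF m] c_def ..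
    note spectrum = eigenvals_gram_gauss_nodes[where c = c, OF strict_mono_v card_less pos]
    show "strictly_hyperbolic_at (flux v dv w lam) m"
      unfolding strictly_hyperbolic_at_def J using diff spectrum(1,2) by blast
    show "\<exists>\<theta> :: 'm \<Rightarrow> real. strict_mono \<theta> \<and>
        range \<theta> = gauss_nodes (mu_star v dv w lam m) CARD('m) \<and>
        eigenvals (jacobian (flux v dv w lam) (at m)) = complex_of_real ` range \<theta> \<and>
        (\<forall>k. v $ Min UNIV < \<theta> k \<and> \<theta> k < v $ Max UNIV)"
      unfolding J mu by (rule spectrum(3))
  qed
qed

end
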